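(* Let $\mu$ be a doubling measure in $\mathbb{R}^n$ with doubling constant $c_\mu$ and doubling dimension $n_\mu$, and let $p>1$, $\alpha\ge0$. Then \[ \|f-f_{Q,\mu}\|_{L^p\log^\alpha L\left(Q,\frac{d\mu}{\mu(Q)}\right)}\le c_\mu 2^{n_\mu}\,e\,2^{\alpha}\,(p+\alpha+1)\,\|f\|_{\mathrm{BMO}(d\mu)} \] for every cube $Q$ in $\mathbb{R}^n$ and every $f\in\mathrm{BMO}(d\mu)$.
   Context: A (nontrivial, Borel, locally finite) measure $\mu$ on $\mathbb{R}^n$ is doubling with doubling constant $c_\mu\ge1$ and doubling dimension $n_\mu>0$ if $\mu(\tilde Q)\le c_\mu(\ell(\tilde Q)/\ell(Q))^{n_\mu}\mu(Q)$ for all cubes $Q\subset\tilde Q$, where $\ell$ denotes side length. Put $f_{Q,\mu}=\frac1{\mu(Q)}\int_Q f\,d\mu$ and $\|f\|_{\mathrm{BMO}(d\mu)}=\sup_{Q}\frac1{\mu(Q)}\int_Q|f-f_{Q,\mu}|\,d\mu$ (supremum over all cubes); $\mathrm{BMO}(d\mu)$ is the set of $f\in L^1_{\mathrm{loc}}(d\mu)$ for which this is finite. The local $L^p\log^\alpha L$ average is the Luxemburg norm \[ \|f\|_{L^p\log^\alpha L\left(Q,\frac{d\mu}{\mu(Q)}\right)}=\inf\left\{\lambda>0:\frac1{\mu(Q)}\int_Q\phi_{p,\alpha}\left(\frac{|f(x)|}{\lambda}\right)d\mu(x)\le1\right\},\qquad \phi_{p,\alpha}(t)=t^p(1+\log^+t)^\alpha,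 \] where $\log^+t=\max\{\log t,0\}$ (and $\phi_{p,\alpha}(0)=0$). *)

theory Defs
  imports "HOL-Analysis.Analysis"
begin

definition cube :: "real ^ 'n \<Rightarrow> real \<Rightarrow> (real ^ 'n) set" where
  "cube a l = cbox a (\<chi> i. a $ i + l)"

text \<open>
  Cubes are closed with sides parallel to the axes; every cube is \<open>cube a l\<close> with corner \<open>a\<close> and
  side length \<open>l > 0\<close>. (For a doubling measure the boundary of a cube is a null set, so it does
  not matter whether cubes are taken open, closed or half-open.)
\<close>

definition locally_finite_measure :: "'a::topological_space measure \<Rightarrow> bool" where
  "locally_finite_measure \<mu> \<longleftrightarrow> (\<forall>x. \<exists>U. open U \<and> x \<in> U \<and> emeasure \<mu> U < \<infinity>)"

definition doubling_measure :: "(real ^ 'n) measure \<Rightarrow> real \<Rightarrow> real \<Rightarrow> bool" where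
  "doubling_measure \<mu> c d \<longleftrightarrow>
     sets \<mu> = sets borel \<and> emeasure \<mu> (space \<mu>) \<noteq> 0 \<and> locally_finite_measure \<mu> \<and>
     1 \<le> c \<and> 0 < d \<and>
     (\<forall>a l b m. 0 < l \<longrightarrow> 0 < m \<longrightarrow> cube a l \<subseteq> cube b m \<longrightarrow>
        emeasure \<mu> (cube b m) \<le> ennreal (c * (m / l) powr d) * emeasure \<mu> (cube a l))"

definition average :: "'a measure \<Rightarrow> 'a set \<Rightarrow> ('a \<Rightarrow> real) \<Rightarrow> real" where
  "average \<mu> Q f = (LINT x:Q|\<mu>. f x) / measure \<mu> Q"

definition locally_integrable :: "'a::topological_space measure \<Rightarrow> ('a \<Rightarrow> real) \<Rightarrow> bool" where
  "locally_integrable \<mu> f \<longleftrightarrow> (\<forall>K. compact K \<longrightarrow> set_integrable \<mu> K f)"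

text \<open>
  The seminorms below take values in \<open>ennreal\<close>, so that an unbounded supremum, the infimum of the
  empty set and a divergent integral all have the value \<open>\<infinity>\<close>.
\<close>

definition bmo_norm :: "(real ^ 'n) measure \<Rightarrow> (real ^ 'n \<Rightarrow> real) \<Rightarrow> ennreal" where
  "bmo_norm \<mu> f =
     (SUP Q \<in> {cube a l | a l. 0 < l}.
        (\<integral>\<^sup>+x\<in>Q. ennreal \<bar>f x - average \<mu> Q f\<bar> \<partial>\<mu>) / emeasure \<mu> Q)"

definition BMO :: "(real ^ 'n) measure \<Rightarrow> (real ^ 'n \<Rightarrow> real) set" where
  "BMO \<mu> = {f. locally_integrable \<mu> f \<and> bmo_norm \<mu> f < \<infinity>}"

text \<open>Since \<open>ln 0 = 0\<close> and \<open>0 powr p = 0\<close>, \<open>young_fun p \<alpha> 0 = 0\<close>.\<close>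

definition young_fun :: "real \<Rightarrow> real \<Rightarrow> real \<Rightarrow> real" where
  "young_fun p \<alpha> t = t powr p * (1 + max (ln t) 0) powr \<alpha>"

definition luxemburg_norm ::
    "real \<Rightarrow> real \<Rightarrow> 'a measure \<Rightarrow> 'a set \<Rightarrow> ('a \<Rightarrow> real) \<Rightarrow> ennreal" where
  "luxemburg_norm p \<alpha> \<mu> Q f =
     (INF t \<in> {t. 0 < t \<and>
        (\<integral>\<^sup>+x\<in>Q. ennreal (young_fun p \<alpha> (\<bar>f x\<bar> / t)) \<partial>\<mu>) / emeasure \<mu> Q \<le> 1}. ennreal t)"

end

theory Submission
  imports Defs
begin

text \<open>
  Let \<open>\<phi>\<close> be the Young function, \<open>\<theta> = 1 / (p + \<alpha> + 1)\<close>, let \<open>B\<close> be any positive upper bound for the BMO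
  norm of \<open>f\<close>, and let \<open>C = c\<^sub>\<mu> 2 powr n\<^sub>\<mu>\<close>, so that the mass of a cube is at most \<open>C\<close> times the mass of
  each of its dyadic children. Put \<open>t = C e (p + \<alpha> + 1) B\<close>; then \<open>C e B = \<theta> t\<close>. The claim is that the
  mean of \<open>\<phi> (\<bar>f - f\<^sub>Q\<bar> / t)\<close> over every cube \<open>Q\<close> is at most \<open>1\<close>.

  Stop the dyadic subdivision of \<open>Q\<close> at the first cubes \<open>R\<close> on which the mean of \<open>\<bar>f - f\<^sub>Q\<bar>\<close> exceeds
  \<open>e B\<close>. They carry at most the fraction \<open>1 / e\<close> of the mass of \<open>Q\<close>, and doubling gives
  \<open>\<bar>f\<^sub>R - f\<^sub>Q\<bar> \<le> C e B = \<theta> t\<close>, while off these cubes \<open>\<bar>f - f\<^sub>Q\<bar> \<le> e B \<le> \<theta> t\<close>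
  almost everywhere. A shift of the argument by \<open>\<theta>\<close> is harmless because
  \<open>\<phi> (\<theta> + s) \<le> \<theta> + (1 - \<theta>) e \<phi> s\<close> (lemma \<open>young_fun_shift\<close>; this is where the factor \<open>p + \<alpha> + 1\<close>
  comes from). Hence, if the claim holds on all stopping cubes, the mean over \<open>Q\<close> is
  at most \<open>\<theta> + (1 - \<theta>) e (1 / e) = 1\<close>.

  To turn this self-improvement into a proof, \<open>f\<close> is replaced by its averages over the dyadic cells
  of depth \<open>m\<close>, and one argues by induction on \<open>m\<close> (lemma \<open>young_dyadic_average_le\<close>); stopping cubes
  then have a smaller remaining depth, and at depth \<open>0\<close> there is nothing to show. The limit \<open>m \<rightarrow> \<infinity>\<close>
  uses the convergence of dyadic averages in \<open>L\<^sup>1\<close> (lemma \<open>dyadic_error_tendsto\<close>), which gives almost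
  everywhere convergence along a subsequence, and Fatou's lemma.

  The dyadic argument is carried out on half-open cubes, which are partitioned by their children.
  A half-open cube is an increasing union of closed cubes, and a closed cube is a decreasing
  intersection of half-open cubes; bounds on mean oscillations pass to both kinds of limit by Fatou's
  lemma (lemma \<open>oscillation_le_of_eventually_mem\<close>).
\<close>

section \<open>The Young function\<close>

lemma young_fun_nonneg: "0 \<le> young_fun p \<alpha> t"
  by (simp add: young_fun_def)

lemma young_fun_0: "young_fun p \<alpha> 0 = 0"
  by (simp add: young_fun_def)

lemma young_fun_below_1: "0 \<le> t \<Longrightarrow> t \<le> 1 \<Longrightarrow> young_fun p \<alpha> t = t powr p"
  by (cases "t = 0") (simp_all add: young_fun_def max_def)

lemma young_fun_above_1: "1 \<le> t \<Longrightarrow> young_fun p \<alpha> t = t powr p * (1 + ln t) powr \<alpha>"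
  by (simp add: young_fun_def max_def)

lemma young_fun_mono:
  assumes "0 \<le> p" "0 \<le> \<alpha>" "0 \<le> s" "s \<le> t"
  shows "young_fun p \<alpha> s \<le> young_fun p \<alpha> t"
proof (cases "s = 0")
  case False
  then have "max (ln s) 0 \<le> max (ln t) 0"
    using assms by (intro max.mono) auto
  then show ?thesis
    unfolding young_fun_def using assms
    by (intro mult_mono powr_mono2) auto
qed (simp add: young_fun_0 young_fun_nonneg)

lemma continuous_on_young_fun:
  assumes "0 < p"
  shows "continuous_on {0..} (young_fun p \<alpha>)"
proof -
  have "continuous_on {0..1} (young_fun p \<alpha>)"
  proof (subst continuous_on_cong[OF refl])
    show "young_fun p \<alpha> t = t powr p" if "t \<in> {0..1}" for t
      using that by (simp add: young_fun_below_1)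
    show "continuous_on {0..1} (\<lambda>t. t powr p)"
      using assms by (intro continuous_on_powr' continuous_intros) auto
  qed
  moreover have "continuous_on {1..} (young_fun p \<alpha>)"
  proof (subst continuous_on_cong[OF refl])
    show "young_fun p \<alpha> t = t powr p * (1 + ln t) powr \<alpha>" if "t \<in> {1..}" for t
      using that by (simp add: young_fun_above_1)
    have "1 + ln t \<noteq> 0" if "1 \<le> t" for t :: real
      using ln_ge_zero[OF that] by linarith
    then show "continuous_on {1..} (\<lambda>t. t powr p * (1 + ln t) powr \<alpha>)"
      by (intro continuous_intros) auto
  qed
  ultimately have "continuous_on ({0..1} \<union> {1..}) (young_fun p \<alpha>)"
    by (intro continuous_on_closed_Un) auto
  also have "{0..1} \<union> {1..} = {0::real..}"
    by auto
  finally show ?thesis .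
qed

text \<open>
  The power contributes \<open>r powr p\<close>. In the logarithmic factor,
  \<open>1 + log\<^sup>+ (r t) \<le> (1 + log r) (1 + log\<^sup>+ t)\<close> and \<open>1 + log r \<le> r\<close>, so that it contributes at most
  \<open>r powr \<alpha>\<close>.
\<close>

lemma young_fun_dilation:
  assumes "0 \<le> p" "0 \<le> \<alpha>" "0 \<le> t" "1 \<le> r"
  shows "young_fun p \<alpha> (r * t) \<le> r powr (p + \<alpha>) * young_fun p \<alpha> t"
proof (cases "t = 0")
  case False
  define w where "w = 1 + max (ln t) 0"
  have "1 + max (ln (r * t)) 0 \<le> (1 + ln r) * w"
    using assms False by (auto simp: w_def ln_mult max_def algebra_simps)
  also have "\<dots> \<le> r * w"
    using ln_le_minus_one[of r] assms by (intro mult_right_mono) (auto simp: w_def)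
  finally have "(1 + max (ln (r * t)) 0) powr \<alpha> \<le> r powr \<alpha> * w powr \<alpha>"
    using assms by (subst powr_mult[symmetric]) (auto simp: w_def intro!: powr_mono2)
  then have "(r * t) powr p * (1 + max (ln (r * t)) 0) powr \<alpha>
      \<le> (r powr p * t powr p) * (r powr \<alpha> * w powr \<alpha>)"
    using assms by (intro mult_mono) (auto simp: powr_mult)
  then show ?thesis
    by (simp add: young_fun_def w_def powr_add mult_ac)
qed (simp add: young_fun_0)

text \<open>
  The derivative is \<open>t powr (p - 1) * k (1 + ln t)\<close> with \<open>k w = p w powr \<alpha> + \<alpha> w powr (\<alpha> - 1)\<close>. For
  \<open>\<alpha> < 1\<close> the second summand of \<open>k\<close> decreases, but \<open>k\<close> itself does not: its derivative is
  \<open>\<alpha> w powr (\<alpha> - 2) * (p w - 1 + \<alpha>)\<close>, and \<open>p w \<ge> 1\<close>.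
\<close>

lemma convex_on_young_fun_above_1:
  assumes "1 \<le> p" "0 \<le> \<alpha>"
  shows "convex_on {1..} (\<lambda>t. t powr p * (1 + ln t) powr \<alpha>)"
proof -
  define k where "k w = p * w powr \<alpha> + \<alpha> * w powr (\<alpha> - 1)" for w :: real
  have k_mono: "k v \<le> k w" if "1 \<le> v" "v \<le> w" for v w
  proof (rule DERIV_nonneg_imp_nondecreasing[OF \<open>v \<le> w\<close>])
    fix x assume x: "v \<le> x" "x \<le> w"
    have x1: "1 \<le> x" using x that by linarith
    have D: "(k has_real_derivative
       p * (\<alpha> * x powr (\<alpha> - 1)) + \<alpha> * ((\<alpha> - 1) * x powr (\<alpha> - 1 - 1))) (at x)"
      unfolding k_def using x1 by (auto intro!: derivative_eq_intros)
    have "x powr (\<alpha> - 1) = x * x powr (\<alpha> - 1 - 1)"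
      using x1 by (simp add: powr_mult_base)
    then have "p * (\<alpha> * x powr (\<alpha> - 1)) + \<alpha> * ((\<alpha> - 1) * x powr (\<alpha> - 1 - 1))
       = \<alpha> * x powr (\<alpha> - 1 - 1) * (p * x - 1 + \<alpha>)"
      by (simp add: algebra_simps)
    moreover have "1 * 1 \<le> p * x"
      using assms x1 by (intro mult_mono) auto
    ultimately show "\<exists>y. (k has_real_derivative y) (at x) \<and> 0 \<le> y"
      using D assms by (intro exI[of _ "\<alpha> * x powr (\<alpha> - 1 - 1) * (p * x - 1 + \<alpha>)"]) auto
  qed
  show ?thesis
  proof (rule convex_on_realI)
    fix x :: real assume "x \<in> {1..}"
    then have x: "1 \<le> x" "0 \<le> ln x" by auto
    have "x powr p = x powr (p - 1) * x" "(1 + ln x) powr \<alpha> = (1 + ln x) powr (\<alpha> - 1) * (1 + ln x)"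
      using x powr_mult_base[of x "p - 1"] powr_mult_base[of "1 + ln x" "\<alpha> - 1"] by (auto simp: mult.commute)
    moreover have w: "0 < 1 + ln x" using x by linarith
    have "((\<lambda>t. t powr p * (1 + ln t) powr \<alpha>) has_real_derivative
        (p * x powr (p - 1)) * (1 + ln x) powr \<alpha> + (\<alpha> * (1 + ln x) powr (\<alpha> - 1) * (1 / x)) * x powr p) (at x)"
      using x w by (intro DERIV_mult) (auto intro!: derivative_eq_intros)
    ultimately show "((\<lambda>t. t powr p * (1 + ln t) powr \<alpha>) has_real_derivative
        x powr (p - 1) * k (1 + ln x)) (at x)"
      unfolding k_def using x by (simp add: field_simps)
  next
    fix x y :: real assume "x \<in> {1..}" "y \<in> {1..}" "x \<le> y"
    then have "1 \<le> x" "x \<le> y" "0 \<le> ln x" "ln x \<le> ln y" by auto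
    then show "x powr (p - 1) * k (1 + ln x) \<le> y powr (p - 1) * k (1 + ln y)"
      using assms by (intro mult_mono k_mono powr_mono2) (auto simp: k_def)
  qed auto
qed

text \<open>
  The two formulas for \<open>\<phi>\<close> meet at \<open>1\<close>, where \<open>\<phi> 1 = 1\<close>. A chord with one end at \<open>1\<close> stays on one side
  of that point, so convexity of each formula on its own side suffices.
\<close>

lemma young_fun_chord:
  assumes "1 \<le> p" "0 \<le> \<alpha>" "0 \<le> t" "0 \<le> \<theta>" "\<theta> < 1"
  shows "young_fun p \<alpha> (\<theta> + (1 - \<theta>) * t) \<le> \<theta> + (1 - \<theta>) * young_fun p \<alpha> t"
proof -
  consider "t = 0" | "0 < t" "t \<le> 1" | "1 \<le> t" using assms by linarith
  then show ?thesis
  proof cases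
    case 1
    have "\<theta> powr p \<le> \<theta>"
      using assms powr_mono'[of 1 p \<theta>] by simp
    then show ?thesis using 1 assms by (simp add: young_fun_0 young_fun_below_1)
  next
    case 2
    have "(\<theta> + (1 - \<theta>) * t) powr p \<le> \<theta> + (1 - \<theta>) * t powr p"
      using convex_onD[OF powr_convex[OF assms(1)], of "1 - \<theta>" 1 t] assms 2 by simp
    moreover have "\<theta> + (1 - \<theta>) * t \<le> \<theta> + (1 - \<theta>) * 1"
      using assms 2 by (intro add_left_mono mult_left_mono) auto
    ultimately show ?thesis using assms 2 by (simp add: young_fun_below_1)
  next
    case 3
    have "\<theta> + (1 - \<theta>) * 1 \<le> \<theta> + (1 - \<theta>) * t"
      using assms 3 by (intro add_left_mono mult_left_mono) auto
    then have z: "1 \<le> \<theta> + (1 - \<theta>) * t" by simp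
    show ?thesis
      using convex_onD[OF convex_on_young_fun_above_1[OF assms(1,2)], of "1 - \<theta>" 1 t] 3 assms z
      by (simp add: young_fun_above_1)
  qed
qed

text \<open>
  Write \<open>\<theta> + s\<close> as the convex combination \<open>\<theta> * 1 + (1 - \<theta>) * (r s)\<close> with \<open>r = 1 / (1 - \<theta>)\<close>. The
  chord inequality bounds \<open>\<phi> (\<theta> + s)\<close> by \<open>\<theta> + (1 - \<theta>) \<phi> (r s)\<close>, and the dilation costs a factor
  \<open>r powr q = (1 + 1 / q) powr q \<le> e\<close> where \<open>q = p + \<alpha>\<close>. The value of \<open>\<theta>\<close> is chosen for the sake of
  this last bound.
\<close>

lemma young_fun_shift:
  assumes "1 \<le> p" "0 \<le> \<alpha>" "0 \<le> s" and \<theta>: "\<theta> = 1 / (p + \<alpha> + 1)"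
  shows "young_fun p \<alpha> (\<theta> + s) \<le> \<theta> + (1 - \<theta>) * (exp 1 * young_fun p \<alpha> s)"
proof -
  define q where "q = p + \<alpha>"
  define r where "r = 1 + 1 / q"
  have q: "0 < q" using assms by (simp add: q_def)
  have th: "0 \<le> \<theta>" "\<theta> < 1" 
    using assms by auto
  have "1 - \<theta> = q / (q + 1)" "r = (q + 1) / q"
    using q unfolding \<theta> r_def q_def[symmetric] by (simp_all add: field_simps)
  then have r: "(1 - \<theta>) * r = 1" "1 \<le> r"
    using q by simp_all
  have "r powr q \<le> exp (1 / q) powr q"
    using r q exp_ge_add_one_self[of "1 / q"] by (intro powr_mono2) (auto simp: r_def)
  also have "\<dots> = exp 1"
    using q by (simp add: exp_powr_real)
  finally have rq: "r powr q \<le> exp 1" .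
  have "\<theta> + s = \<theta> + (1 - \<theta>) * (r * s)"
    using r(1) by (metis mult.assoc mult_1)
  then have "young_fun p \<alpha> (\<theta> + s) = young_fun p \<alpha> (\<theta> + (1 - \<theta>) * (r * s))"
    by (rule arg_cong)
  also have "\<dots> \<le> \<theta> + (1 - \<theta>) * young_fun p \<alpha> (r * s)"
    using assms(1-3) r th by (intro young_fun_chord) auto
  also have "young_fun p \<alpha> (r * s) \<le> r powr q * young_fun p \<alpha> s"
    unfolding q_def using assms r by (intro young_fun_dilation) auto
  also have "\<dots> \<le> exp 1 * young_fun p \<alpha> s"
    using rq by (intro mult_right_mono young_fun_nonneg)
  finally show ?thesis using th by simp
qed

section \<open>Dyadic cells of half-open cubes\<close>

definition half_open_cube :: "real ^ 'n \<Rightarrow> real \<Rightarrow> (real ^ 'n) set" where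
  "half_open_cube a l = {x. \<forall>i. a $ i \<le> x $ i \<and> x $ i < a $ i + l}"

lemma half_open_cube_measurable [measurable]: "half_open_cube a l \<in> sets borel"
proof -
  have "half_open_cube a l = (\<Inter>i. {x. a $ i \<le> x $ i} \<inter> {x. x $ i < a $ i + l})"
    by (auto simp: half_open_cube_def)
  also have "\<dots> \<in> sets borel"
    by (intro sets.countable_INT'' sets.Int borel_closed borel_open closed_Collect_le open_Collect_less
        continuous_intros) auto
  finally show ?thesis .
qed

text \<open>
  The lower corner of the dyadic child of \<open>half_open_cube a l\<close> that contains \<open>x\<close>. The points outside
  the cube are assigned to a child as well; thus the corners of all children form \<open>range (corner a l)\<close>.
\<close>

definition corner :: "real ^ 'n \<Rightarrow> real \<Rightarrow> real ^ 'n \<Rightarrow> real ^ 'n" where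
  "corner a l x = (\<chi> i. if x $ i < a $ i + l / 2 then a $ i else a $ i + l / 2)"

lemma finite_range_corner: "finite (range (corner a l))"
proof (rule finite_subset)
  show "range (corner a l) \<subseteq> (\<lambda>S. \<chi> i. if i \<in> S then a $ i else a $ i + l / 2) ` UNIV"
  proof safe
    fix x
    show "corner a l x \<in> range (\<lambda>S. \<chi> i. if i \<in> S then a $ i else a $ i + l / 2)"
      by (rule range_eqI[of _ _ "{i. x $ i < a $ i + l / 2}"]) (simp add: corner_def)
  qed
qed simp

lemma mem_half_open_cube_corner_iff:
  assumes "0 < l" "b \<in> range (corner a l)"
  shows "x \<in> half_open_cube b (l / 2) \<longleftrightarrow> x \<in> half_open_cube a l \<and> corner a l x = b"
proof -
  obtain z where "b = corner a l z"
    using assms(2) by auto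
  then have b: "b $ i = a $ i \<or> b $ i = a $ i + l / 2" for i
    by (simp add: corner_def)
  show ?thesis
  proof safe
    assume x: "x \<in> half_open_cube b (l / 2)"
    have *: "a $ i \<le> x $ i \<and> x $ i < a $ i + l \<and> corner a l x $ i = b $ i" for i
      using x b[of i] assms(1)
      by (auto simp: half_open_cube_def corner_def dest!: spec[of _ i])
    then show "x \<in> half_open_cube a l" "corner a l x = b"
      by (auto simp: half_open_cube_def vec_eq_iff)
  next
    assume x: "x \<in> half_open_cube a l"
    have "corner a l x $ i \<le> x $ i \<and> x $ i < corner a l x $ i + l / 2" for i
      using x by (auto simp: half_open_cube_def corner_def dest: spec[of _ i])
    then show "x \<in> half_open_cube (corner a l x) (l / 2)"
      by (simp add: half_open_cube_def)
  qed
qed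

lemma half_open_cube_corner_subset:
  "0 < l \<Longrightarrow> half_open_cube (corner a l x) (l / 2) \<subseteq> half_open_cube a l"
  using mem_half_open_cube_corner_iff[of l "corner a l x" a] by auto

lemma mem_half_open_cube_corner:
  "0 < l \<Longrightarrow> x \<in> half_open_cube a l \<Longrightarrow> x \<in> half_open_cube (corner a l x) (l / 2)"
  using mem_half_open_cube_corner_iff[of l "corner a l x" a] by auto

lemma nn_integral_half_open_cube_split:
  fixes u :: "real ^ 'n \<Rightarrow> ennreal"
  assumes "0 < l" and [measurable_cong]: "sets \<mu> = sets borel" and [measurable]: "u \<in> borel_measurable \<mu>"
  shows "(\<integral>\<^sup>+x\<in>half_open_cube a l. u x \<partial>\<mu>)
    = (\<Sum>b\<in>range (corner a l). \<integral>\<^sup>+x\<in>half_open_cube b (l / 2). u x \<partial>\<mu>)"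
proof -
  have "u x * indicator (half_open_cube a l) x
      = (\<Sum>b\<in>range (corner a l). u x * indicator (half_open_cube b (l / 2)) x)" for x
  proof -
    have "(\<Sum>b\<in>range (corner a l). u x * indicator (half_open_cube b (l / 2)) x)
       = (\<Sum>b\<in>range (corner a l). if b = corner a l x then u x * indicator (half_open_cube a l) x else 0)"
    proof (rule sum.cong[OF refl])
      fix b assume "b \<in> range (corner a l)"
      from mem_half_open_cube_corner_iff[OF assms(1) this, of x]
      show "u x * indicator (half_open_cube b (l / 2)) x
          = (if b = corner a l x then u x * indicator (half_open_cube a l) x else 0)"
        by (cases "b = corner a l x") (simp_all add: indicator_def)
    qed
    also have "\<dots> = u x * indicator (half_open_cube a l) x"
      by (subst sum.delta[OF finite_range_corner]) simp
    finally show ?thesis by simp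
  qed
  then have "(\<integral>\<^sup>+x\<in>half_open_cube a l. u x \<partial>\<mu>)
      = (\<integral>\<^sup>+x. (\<Sum>b\<in>range (corner a l). u x * indicator (half_open_cube b (l / 2)) x) \<partial>\<mu>)"
    by (intro nn_integral_cong)
  also have "\<dots> = (\<Sum>b\<in>range (corner a l). \<integral>\<^sup>+x\<in>half_open_cube b (l / 2). u x \<partial>\<mu>)"
    by (rule nn_integral_sum) measurable
  finally show ?thesis .
qed

text \<open>
  For \<open>x\<close> in \<open>half_open_cube a l\<close>, this is the dyadic subcube of side length \<open>l / 2 ^ m\<close> that contains
  \<open>x\<close>. The recursion descends through the child containing \<open>x\<close>, in step with the inductions over the
  dyadic tree.
\<close>

primrec cell :: "nat \<Rightarrow> real ^ 'n \<Rightarrow> real \<Rightarrow> real ^ 'n \<Rightarrow> (real ^ 'n) set" where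
  "cell 0 a l x = half_open_cube a l"
| "cell (Suc m) a l x = cell m (corner a l x) (l / 2) x"

lemma cell_eq_half_open_cube: "\<exists>b. cell m a l x = half_open_cube b (l / 2 ^ m)"
proof (induction m arbitrary: a l)
  case (Suc m)
  show ?case using Suc[of "corner a l x" "l / 2"] by (simp add: field_simps)
qed auto

lemma cell_subset: "0 < l \<Longrightarrow> cell m a l x \<subseteq> half_open_cube a l"
proof (induction m arbitrary: a l)
  case (Suc m)
  have "cell m (corner a l x) (l / 2) x \<subseteq> half_open_cube (corner a l x) (l / 2)"
    using Suc.prems by (intro Suc.IH) simp
  also have "\<dots> \<subseteq> half_open_cube a l"
    using Suc.prems by (rule half_open_cube_corner_subset)
  finally show ?case by simp
qed auto

lemma mem_cell: "0 < l \<Longrightarrow> x \<in> half_open_cube a l \<Longrightarrow> x \<in> cell m a l x"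
proof (induction m arbitrary: a l)
  case (Suc m)
  then show ?case
    using mem_half_open_cube_corner[of l x a] Suc(1)[of "l / 2" "corner a l x"] by auto
qed auto

lemma cell_eq: "0 < l \<Longrightarrow> y \<in> cell m a l x \<Longrightarrow> cell m a l y = cell m a l x"
proof (induction m arbitrary: a l)
  case (Suc m)
  then have "y \<in> half_open_cube (corner a l x) (l / 2)"
    using cell_subset[of "l / 2" m "corner a l x" x] by auto
  then have "corner a l y = corner a l x"
    using Suc.prems mem_half_open_cube_corner_iff[of l "corner a l x" a y] by auto
  then show ?case using Suc by simp
qed auto

lemma measurable_corner: "corner a l \<in> measurable borel (count_space (range (corner a l)))"
proof -
  have "{x. corner a l x = b} \<in> sets borel" for b
  proof -
    have "{x. corner a l x = b} = (\<Inter>i. {x. corner a l x $ i = b $ i})"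
      by (auto simp: vec_eq_iff)
    also have "\<dots> \<in> sets borel"
    proof (rule sets.countable_INT'')
      fix i
      have "{x. x $ i < a $ i + l / 2} \<in> sets borel"
        by (intro borel_open open_Collect_less continuous_intros)
      moreover have "{x. corner a l x $ i = b $ i} =
         (if a $ i = b $ i then {x. x $ i < a $ i + l / 2} else {}) \<union>
         (if a $ i + l / 2 = b $ i then - {x. x $ i < a $ i + l / 2} else {})"
        by (auto simp: corner_def)
      ultimately show "{x. corner a l x $ i = b $ i} \<in> sets borel"
        by auto
    qed auto
    finally show ?thesis .
  qed
  then show ?thesis
    by (auto simp: measurable_count_space_eq2 finite_range_corner vimage_def)
qed

text \<open>
  There are finitely many cells of each depth, so that any function of the cell, here a real-valued
  one, is measurable.
\<close>

lemma borel_measurable_cell: "(\<lambda>x. g (cell m a l x)) \<in> borel_measurable borel"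
proof (induction m arbitrary: a l)
  case (Suc m)
  have "(\<lambda>x. g (cell m (corner a l x) (l / 2) x)) \<in> borel_measurable borel"
    by (rule measurable_compose_countable'[OF _ measurable_corner])
       (auto intro: Suc countable_finite finite_range_corner)
  then show ?case by simp
qed simp

lemma eventually_cell_subset:
  fixes x :: "real ^ 'n"
  assumes "0 < l" "open U" "x \<in> U" "x \<in> half_open_cube a l"
  shows "eventually (\<lambda>m. cell m a l x \<subseteq> U) sequentially"
proof -
  obtain e where e: "0 < e" "ball x e \<subseteq> U"
    using assms by (auto simp: open_contains_ball)
  have "(\<lambda>m. real CARD('n) * (l * (1 / 2) ^ m)) \<longlonglongrightarrow> real CARD('n) * (l * 0)"
    by (intro tendsto_intros LIMSEQ_power_zero) auto
  then have "eventually (\<lambda>m. real CARD('n) * (l * (1 / 2) ^ m) < e) sequentially"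
    using e by (intro order_tendstoD(2)) auto
  then show ?thesis
  proof eventually_elim
    case (elim m)
    obtain b where b: "cell m a l x = half_open_cube b (l / 2 ^ m)"
      using cell_eq_half_open_cube by blast
    have "y \<in> U" if y: "y \<in> cell m a l x" for y
    proof -
      have x: "x \<in> cell m a l x"
        using assms by (intro mem_cell)
      have "norm (x - y) \<le> (\<Sum>i\<in>UNIV. \<bar>(x - y) $ i\<bar>)"
        by (rule norm_le_l1_cart)
      also have "\<dots> \<le> (\<Sum>i\<in>(UNIV :: 'n set). l / 2 ^ m)"
      proof (rule sum_mono)
        fix i
        show "\<bar>(x - y) $ i\<bar> \<le> l / 2 ^ m"
          using x y unfolding b half_open_cube_def by (auto simp: abs_le_iff dest!: spec[of _ i])
      qed
      also have "\<dots> = real CARD('n) * (l * (1 / 2) ^ m)"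
        by (simp add: power_one_over)
      also have "\<dots> < e" by (rule elim)
      finally have "dist x y < e"
        by (simp only: dist_norm)
      then show "y \<in> U" using e(2) by auto
    qed
    then show ?case by auto
  qed
qed

section \<open>Convergence of dyadic averages\<close>

lemma average_cong: "(\<And>x. x \<in> R \<Longrightarrow> f x = g x) \<Longrightarrow> average \<mu> R f = average \<mu> R g"
  unfolding average_def set_lebesgue_integral_def
  by (intro arg_cong2[where f = "(/)"] Bochner_Integration.integral_cong) (auto simp: indicator_def)

text \<open>
  The difference \<open>f\<^sub>R - c\<close> is the average of \<open>f - c\<close> over \<open>R\<close>. The inequality is multiplied out by the
  mass of \<open>R\<close>, so that the terms on its right-hand side can be added up over a partition.
\<close>

lemma average_diff_le:
  assumes R: "R \<in> sets \<mu>" "0 < emeasure \<mu> R" "emeasure \<mu> R < \<infinity>" and f: "set_integrable \<mu> R f"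
  shows "ennreal \<bar>average \<mu> R f - c\<bar> * emeasure \<mu> R \<le> (\<integral>\<^sup>+x\<in>R. ennreal \<bar>f x - c\<bar> \<partial>\<mu>)"
proof -
  have m: "emeasure \<mu> R = ennreal (measure \<mu> R)" "0 < measure \<mu> R"
    using R by (auto simp: emeasure_eq_ennreal_measure less_top[symmetric] zero_less_measure_iff)
  have c: "set_integrable \<mu> R (\<lambda>_. c)"
    using R by (simp add: set_integrable_def)
  have fc: "set_integrable \<mu> R (\<lambda>x. f x - c)"
    using f c by (rule set_integral_diff)
  have "(LINT x:R|\<mu>. f x - c) = (LINT x:R|\<mu>. f x) - (LINT x:R|\<mu>. c)"
    using f c by (rule set_integral_diff)
  also have "(LINT x:R|\<mu>. c) = measure \<mu> R * c"
    using R by (simp add: set_lebesgue_integral_def)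
  finally have "(average \<mu> R f - c) * measure \<mu> R = (LINT x:R|\<mu>. f x - c)"
    using m by (simp add: average_def left_diff_distrib)
  then have "\<bar>average \<mu> R f - c\<bar> * measure \<mu> R = norm (LINT x:R|\<mu>. f x - c)"
    by (metis abs_mult abs_of_pos m(2) real_norm_def)
  also have "ennreal \<dots> \<le> (\<integral>\<^sup>+x. ennreal (norm (indicator R x *\<^sub>R (f x - c))) \<partial>\<mu>)"
    unfolding set_lebesgue_integral_def
    using fc unfolding set_integrable_def by (rule integral_norm_bound_ennreal)
  also have "\<dots> = (\<integral>\<^sup>+x\<in>R. ennreal \<bar>f x - c\<bar> \<partial>\<mu>)"
    by (intro nn_integral_cong) (simp add: indicator_def)
  finally show ?thesis
    using m by (simp add: ennreal_mult)
qed

definition dyadic_average ::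
    "(real ^ 'n) measure \<Rightarrow> nat \<Rightarrow> real ^ 'n \<Rightarrow> real \<Rightarrow> (real ^ 'n \<Rightarrow> real) \<Rightarrow> real ^ 'n \<Rightarrow> real" where
  "dyadic_average \<mu> m a l f x = average \<mu> (cell m a l x) f"

text \<open>
  On such a measure every average over a cell divides by a positive finite mass.
\<close>

locale half_open_cube_measure =
  fixes \<mu> :: "(real ^ 'n) measure"
  assumes sets_eq [measurable_cong, simp]: "sets \<mu> = sets borel"
    and emeasure_cube_pos: "0 < l \<Longrightarrow> 0 < emeasure \<mu> (half_open_cube a l)"
    and emeasure_cube_finite: "emeasure \<mu> (half_open_cube a l) < \<infinity>"
begin

lemma space_eq [simp]: "space \<mu> = UNIV"
  using sets_eq_imp_space_eq[OF sets_eq] by simp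

lemma measure_cube_pos: "0 < l \<Longrightarrow> 0 < measure \<mu> (half_open_cube a l)"
  using emeasure_cube_pos[of l a] emeasure_cube_finite[of a l]
  by (simp add: emeasure_eq_ennreal_measure less_top)

lemma set_integrable_borel:
  fixes f :: "real ^ 'n \<Rightarrow> real"
  shows "integrable \<mu> f \<Longrightarrow> A \<in> sets borel \<Longrightarrow> set_integrable \<mu> A f"
  unfolding set_integrable_def by (rule integrable_mult_indicator) simp_all

lemma integrable_indicator_subset:
  assumes "A \<subseteq> half_open_cube a l" "A \<in> sets borel"
  shows "integrable \<mu> (indicator A :: real ^ 'n \<Rightarrow> real)"
proof -
  have "emeasure \<mu> A \<le> emeasure \<mu> (half_open_cube a l)"
    using assms by (intro emeasure_mono) auto
  then have "emeasure \<mu> A < \<infinity>"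
    using emeasure_cube_finite[of a l] by (rule le_less_trans)
  then show ?thesis
    using assms by (simp add: integrable_indicator_iff)
qed

lemma cell_measurable: "cell m a l x \<in> sets \<mu>"
  using cell_eq_half_open_cube[of m a l x] by auto

lemma measure_cell_pos: "0 < l \<Longrightarrow> 0 < measure \<mu> (cell m a l x)"
  using cell_eq_half_open_cube[of m a l x] measure_cube_pos[of "l / 2 ^ m"] by auto

lemma emeasure_cell_finite: "emeasure \<mu> (cell m a l x) < \<infinity>"
  using cell_eq_half_open_cube[of m a l x] emeasure_cube_finite by auto

lemma borel_measurable_dyadic_average [measurable]: "dyadic_average \<mu> m a l f \<in> borel_measurable \<mu>"
  unfolding dyadic_average_def measurable_cong_sets[OF sets_eq refl] by (rule borel_measurable_cell)

lemma dyadic_average_Suc: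
  assumes "0 < l" "b \<in> range (corner a l)" "x \<in> half_open_cube b (l / 2)"
  shows "dyadic_average \<mu> (Suc m) a l f x = dyadic_average \<mu> m b (l / 2) f x"
  using mem_half_open_cube_corner_iff[OF assms(1,2)] assms(3) by (simp add: dyadic_average_def)

text \<open>
  Going one level deeper splits an integral of dyadic averages over the children, each of which is the
  root of its own dyadic tree; this is the step of every induction on the depth.
\<close>

lemma nn_integral_dyadic_average_Suc:
  assumes "0 < l" "u \<in> borel_measurable borel"
  shows "(\<integral>\<^sup>+x\<in>half_open_cube a l. u (dyadic_average \<mu> (Suc m) a l f x) \<partial>\<mu>)
    = (\<Sum>b\<in>range (corner a l).
        \<integral>\<^sup>+x\<in>half_open_cube b (l / 2). u (dyadic_average \<mu> m b (l / 2) f x) \<partial>\<mu>)"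
proof -
  note [measurable] = assms(2)
  have "(\<integral>\<^sup>+x\<in>half_open_cube a l. u (dyadic_average \<mu> (Suc m) a l f x) \<partial>\<mu>)
      = (\<Sum>b\<in>range (corner a l).
        \<integral>\<^sup>+x\<in>half_open_cube b (l / 2). u (dyadic_average \<mu> (Suc m) a l f x) \<partial>\<mu>)"
    by (intro nn_integral_half_open_cube_split assms) measurable
  also have "\<dots> = (\<Sum>b\<in>range (corner a l).
        \<integral>\<^sup>+x\<in>half_open_cube b (l / 2). u (dyadic_average \<mu> m b (l / 2) f x) \<partial>\<mu>)"
    using dyadic_average_Suc[OF assms(1)]
    by (intro sum.cong nn_integral_cong refl) (simp add: indicator_def)
  finally show ?thesis .
qed

lemma average_diff_cube_le:
  assumes "0 < l" "set_integrable \<mu> (half_open_cube a l) f"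
  shows "ennreal \<bar>average \<mu> (half_open_cube a l) f - c\<bar> * emeasure \<mu> (half_open_cube a l)
    \<le> (\<integral>\<^sup>+x\<in>half_open_cube a l. ennreal \<bar>f x - c\<bar> \<partial>\<mu>)"
  by (intro average_diff_le assms emeasure_cube_pos emeasure_cube_finite) auto

lemma dyadic_average_contraction:
  assumes "0 < l" "f \<in> borel_measurable \<mu>" "set_integrable \<mu> (half_open_cube a l) f"
  shows "(\<integral>\<^sup>+x\<in>half_open_cube a l. ennreal \<bar>dyadic_average \<mu> m a l f x\<bar> \<partial>\<mu>)
    \<le> (\<integral>\<^sup>+x\<in>half_open_cube a l. ennreal \<bar>f x\<bar> \<partial>\<mu>)"
  using assms(1,3)
proof (induction m arbitrary: a l)
  case 0
  then show ?case
    using average_diff_cube_le[of l a f 0]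
    by (simp add: dyadic_average_def nn_integral_cmult_indicator)
next
  case (Suc m)
  have "(\<integral>\<^sup>+x\<in>half_open_cube a l. ennreal \<bar>dyadic_average \<mu> (Suc m) a l f x\<bar> \<partial>\<mu>)
     = (\<Sum>b\<in>range (corner a l).
        \<integral>\<^sup>+x\<in>half_open_cube b (l / 2). ennreal \<bar>dyadic_average \<mu> m b (l / 2) f x\<bar> \<partial>\<mu>)"
    using Suc.prems by (intro nn_integral_dyadic_average_Suc[where u = "\<lambda>t. ennreal \<bar>t\<bar>"]) auto
  also have "\<dots> \<le> (\<Sum>b\<in>range (corner a l). \<integral>\<^sup>+x\<in>half_open_cube b (l / 2). ennreal \<bar>f x\<bar> \<partial>\<mu>)"
  proof (rule sum_mono)
    fix b assume "b \<in> range (corner a l)"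
    then have "half_open_cube b (l / 2) \<subseteq> half_open_cube a l"
      using half_open_cube_corner_subset Suc.prems by blast
    then show "(\<integral>\<^sup>+x\<in>half_open_cube b (l / 2). ennreal \<bar>dyadic_average \<mu> m b (l / 2) f x\<bar> \<partial>\<mu>)
        \<le> (\<integral>\<^sup>+x\<in>half_open_cube b (l / 2). ennreal \<bar>f x\<bar> \<partial>\<mu>)"
      using Suc.prems by (intro Suc.IH set_integrable_subset[OF Suc.prems(2)]) auto
  qed
  also have "\<dots> = (\<integral>\<^sup>+x\<in>half_open_cube a l. ennreal \<bar>f x\<bar> \<partial>\<mu>)"
    using assms(2) Suc.prems by (intro nn_integral_half_open_cube_split[symmetric]) auto
  finally show ?case .
qed

lemma dyadic_average_add:
  assumes "0 < l" "integrable \<mu> f" "integrable \<mu> g"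
  shows "dyadic_average \<mu> m a l (\<lambda>x. f x + g x) x = dyadic_average \<mu> m a l f x + dyadic_average \<mu> m a l g x"
proof -
  have "set_integrable \<mu> (cell m a l x) f" "set_integrable \<mu> (cell m a l x) g"
    using assms cell_measurable by (auto intro!: set_integrable_borel)
  then show ?thesis
    by (simp add: dyadic_average_def average_def set_integral_add add_divide_distrib)
qed

lemma dyadic_average_cmult: "dyadic_average \<mu> m a l (\<lambda>x. c * f x) x = c * dyadic_average \<mu> m a l f x"
  by (simp add: dyadic_average_def average_def)

definition dyadic_error :: "nat \<Rightarrow> real ^ 'n \<Rightarrow> real \<Rightarrow> (real ^ 'n \<Rightarrow> real) \<Rightarrow> ennreal" where
  "dyadic_error m a l f = (\<integral>\<^sup>+x\<in>half_open_cube a l. ennreal \<bar>dyadic_average \<mu> m a l f x - f x\<bar> \<partial>\<mu>)"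

lemma dyadic_error_add_le:
  assumes "0 < l" and f: "integrable \<mu> f" and g: "integrable \<mu> g"
  shows "dyadic_error m a l (\<lambda>x. f x + g x) \<le> dyadic_error m a l f + dyadic_error m a l g"
proof -
  note [measurable] = borel_measurable_integrable[OF f] borel_measurable_integrable[OF g]
  let ?H = "half_open_cube a l"
  let ?E = "dyadic_average \<mu> m a l"
  have "dyadic_error m a l (\<lambda>x. f x + g x)
      \<le> (\<integral>\<^sup>+x. ennreal \<bar>?E f x - f x\<bar> * indicator ?H x + ennreal \<bar>?E g x - g x\<bar> * indicator ?H x \<partial>\<mu>)"
    unfolding dyadic_error_def dyadic_average_add[OF assms]
    by (intro nn_integral_mono) (auto simp: indicator_def simp flip: ennreal_plus)
  also have "\<dots> = dyadic_error m a l f + dyadic_error m a l g"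
    unfolding dyadic_error_def by (intro nn_integral_add) measurable
  finally show ?thesis .
qed

lemma dyadic_error_le:
  assumes "0 < l" and f: "integrable \<mu> f"
  shows "dyadic_error m a l f \<le> 2 * (\<integral>\<^sup>+x\<in>half_open_cube a l. ennreal \<bar>f x\<bar> \<partial>\<mu>)"
proof -
  note [measurable] = borel_measurable_integrable[OF f]
  let ?H = "half_open_cube a l"
  let ?E = "dyadic_average \<mu> m a l"
  have "dyadic_error m a l f
      \<le> (\<integral>\<^sup>+x. ennreal \<bar>?E f x\<bar> * indicator ?H x + ennreal \<bar>f x\<bar> * indicator ?H x \<partial>\<mu>)"
    unfolding dyadic_error_def
    by (intro nn_integral_mono) (auto simp: indicator_def simp flip: ennreal_plus)
  also have "\<dots> = (\<integral>\<^sup>+x\<in>?H. ennreal \<bar>?E f x\<bar> \<partial>\<mu>) + (\<integral>\<^sup>+x\<in>?H. ennreal \<bar>f x\<bar> \<partial>\<mu>)"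
    by (intro nn_integral_add) measurable
  also have "(\<integral>\<^sup>+x\<in>?H. ennreal \<bar>?E f x\<bar> \<partial>\<mu>) \<le> (\<integral>\<^sup>+x\<in>?H. ennreal \<bar>f x\<bar> \<partial>\<mu>)"
    using assms by (intro dyadic_average_contraction) (auto intro!: set_integrable_borel)
  finally show ?thesis by (simp add: mult_2 add_right_mono)
qed

text \<open>
  The functions whose dyadic averages converge form a closed subset of \<open>L\<^sup>1\<close>, because taking dyadic
  averages is a contraction of \<open>L\<^sup>1\<close>.
\<close>

lemma dyadic_error_tendsto_approx:
  assumes "0 < l" and f: "integrable \<mu> f"
    and approx: "\<And>e. 0 < e \<Longrightarrow> \<exists>g. integrable \<mu> g \<and> (\<lambda>m. dyadic_error m a l g) \<longlonglongrightarrow> 0 \<and>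
      (\<integral>\<^sup>+x\<in>half_open_cube a l. ennreal \<bar>f x - g x\<bar> \<partial>\<mu>) \<le> ennreal e"
  shows "(\<lambda>m. dyadic_error m a l f) \<longlonglongrightarrow> 0"
proof (rule order_tendstoI)
  fix y :: ennreal assume "0 < y"
  then obtain z where z: "0 < z" "z < y"
    using dense by blast
  then obtain e where "z = ennreal e" "0 \<le> e"
    by (cases z) auto
  with z have e: "0 < e" "ennreal e < y" by auto
  obtain g where g: "integrable \<mu> g" "(\<lambda>m. dyadic_error m a l g) \<longlonglongrightarrow> 0"
    and le: "(\<integral>\<^sup>+x\<in>half_open_cube a l. ennreal \<bar>f x - g x\<bar> \<partial>\<mu>) \<le> ennreal (e / 4)"
    using approx[of "e / 4"] e by auto
  have "eventually (\<lambda>m. dyadic_error m a l g < ennreal (e / 2)) sequentially"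
    using e by (intro order_tendstoD(2)[OF g(2)]) auto
  then show "eventually (\<lambda>m. dyadic_error m a l f < y) sequentially"
  proof eventually_elim
    case (elim m)
    have "dyadic_error m a l f = dyadic_error m a l (\<lambda>x. g x + (f x - g x))" by simp
    also have "\<dots> \<le> dyadic_error m a l g + dyadic_error m a l (\<lambda>x. f x - g x)"
      using assms g by (intro dyadic_error_add_le) auto
    also have "\<dots> \<le> ennreal (e / 2) + 2 * ennreal (e / 4)"
    proof (rule add_mono)
      have "dyadic_error m a l (\<lambda>x. f x - g x)
          \<le> 2 * (\<integral>\<^sup>+x\<in>half_open_cube a l. ennreal \<bar>f x - g x\<bar> \<partial>\<mu>)"
        using assms g by (intro dyadic_error_le) auto
      also have "\<dots> \<le> 2 * ennreal (e / 4)"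
        by (intro mult_left_mono le) simp
      finally show "dyadic_error m a l (\<lambda>x. f x - g x) \<le> 2 * ennreal (e / 4)" .
    qed (use elim in auto)
    also have "2 * ennreal (e / 4) = ennreal (e / 2)"
      using e by (simp add: mult_2 flip: ennreal_plus)
    also have "ennreal (e / 2) + ennreal (e / 2) = ennreal e"
      using e by (simp flip: ennreal_plus)
    finally show ?case using e by simp
  qed
qed simp

lemma dyadic_error_cong:
  assumes "0 < l" "\<And>x. x \<in> half_open_cube a l \<Longrightarrow> f x = g x"
  shows "dyadic_error m a l f = dyadic_error m a l g"
proof -
  have "dyadic_average \<mu> m a l f x = dyadic_average \<mu> m a l g x" for x
    unfolding dyadic_average_def using cell_subset[OF assms(1)] assms(2)
    by (intro average_cong) blast
  then show ?thesis
    unfolding dyadic_error_def using assms by (intro nn_integral_cong) (simp add: indicator_def)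
qed

text \<open>
  The cells of depth \<open>m\<close> inside \<open>U\<close> fill up a set \<open>V m\<close> whose indicator is its own dyadic average.
  The rest \<open>U' - V m\<close> of the open set shrinks to the empty set, and the contraction property bounds
  the error by twice its mass.
\<close>

lemma dyadic_error_open_tendsto:
  assumes "0 < l" "open U" "U' = U \<inter> half_open_cube a l"
  shows "(\<lambda>m. dyadic_error m a l (indicator U')) \<longlonglongrightarrow> 0"
proof -
  let ?H = "half_open_cube a l"
  have [measurable]: "U \<in> sets borel" using assms by auto
  define V where "V m = {x \<in> ?H. cell m a l x \<subseteq> U}" for m
  \<comment> \<open>Membership in \<open>V m\<close> depends only on the cell, and the cells are finite in number.\<close>
  have V_sets [measurable]: "V m \<in> sets borel" for m
  proof -
    have "{x. indicator {R. R \<subseteq> U} (cell m a l x) = (1 :: real)} \<in> sets borel"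
      using borel_measurable_cell[of "indicator {R. R \<subseteq> U}" m a l] by measurable
    moreover have "V m = ?H \<inter> {x. indicator {R. R \<subseteq> U} (cell m a l x) = (1 :: real)}"
      by (auto simp: V_def indicator_def)
    ultimately show ?thesis by auto
  qed
  have VU: "V m \<subseteq> U'" for m
    using mem_cell[OF assms(1)] by (auto simp: V_def assms(3))
  note int = integrable_indicator_subset[of _ a l]
  have U'_sets [measurable]: "U' \<in> sets borel" by (simp add: assms(3))
  have 0: "dyadic_error m a l (indicator (V m)) = 0" for m
  proof -
    have "dyadic_average \<mu> m a l (indicator (V m)) x = indicator (V m) x" if x: "x \<in> ?H" for x
    proof -
      have "indicator (V m) y = (indicator (V m) x :: real)" if "y \<in> cell m a l x" for y
        using cell_eq[OF assms(1) that] subsetD[OF cell_subset[OF assms(1)] that] x by (auto simp: V_def indicator_def)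
      then have "dyadic_average \<mu> m a l (indicator (V m)) x = average \<mu> (cell m a l x) (\<lambda>_. indicator (V m) x)"
        unfolding dyadic_average_def by (intro average_cong)
      also have "\<dots> = indicator (V m) x"
        using measure_cell_pos[OF assms(1), of m a x] cell_measurable[of m a l x] emeasure_cell_finite[of m a l x]
        by (simp add: average_def set_lebesgue_integral_def)
      finally show ?thesis .
    qed
    then show ?thesis
      unfolding dyadic_error_def by (subst nn_integral_cong[where v = "\<lambda>_. 0"]) (auto simp: indicator_def)
  qed
  have le: "dyadic_error m a l (indicator U') \<le> 2 * emeasure \<mu> (U' - V m)" for m
  proof -
    have "dyadic_error m a l (indicator U')
        = dyadic_error m a l (\<lambda>x. indicator (V m) x + indicator (U' - V m) x)"
      using VU by (intro arg_cong[where f = "dyadic_error m a l"]) (auto simp: indicator_def fun_eq_iff)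
    also have "\<dots> \<le> dyadic_error m a l (indicator (V m)) + dyadic_error m a l (indicator (U' - V m))"
      by (intro dyadic_error_add_le int assms) (use VU[of m] V_sets[of m] U'_sets in \<open>auto simp: assms(3)\<close>)
    also have "\<dots> = dyadic_error m a l (indicator (U' - V m))" by (simp add: 0)
    also have "\<dots> \<le> 2 * (\<integral>\<^sup>+x\<in>?H. ennreal \<bar>indicator (U' - V m) x\<bar> \<partial>\<mu>)"
      by (intro dyadic_error_le int assms) (use VU[of m] V_sets[of m] U'_sets in \<open>auto simp: assms(3)\<close>)
    also have "(\<integral>\<^sup>+x\<in>?H. ennreal \<bar>indicator (U' - V m) x\<bar> \<partial>\<mu>) = (\<integral>\<^sup>+x. indicator (U' - V m) x \<partial>\<mu>)"
      by (intro nn_integral_cong) (auto simp: indicator_def assms(3))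
    also have "\<dots> = emeasure \<mu> (U' - V m)" by simp
    finally show ?thesis .
  qed
  have "(\<lambda>m. \<integral>\<^sup>+x. indicator (U' - V m) x \<partial>\<mu>) \<longlonglongrightarrow> (\<integral>\<^sup>+x. 0 \<partial>\<mu>)"
  proof (rule nn_integral_dominated_convergence[where w = "indicator ?H"])
    show "AE x in \<mu>. (\<lambda>m. indicator (U' - V m) x :: ennreal) \<longlonglongrightarrow> 0"
    proof (rule AE_I2)
      fix x
      have "eventually (\<lambda>m. indicator (U' - V m) x = (0 :: ennreal)) sequentially"
      proof (cases "x \<in> U'")
        case True
        then have "eventually (\<lambda>m. cell m a l x \<subseteq> U) sequentially"
          using assms by (intro eventually_cell_subset) auto
        then show ?thesis
          by eventually_elim (use True in \<open>auto simp: V_def assms(3)\<close>)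
      qed simp
      then show "(\<lambda>m. indicator (U' - V m) x :: ennreal) \<longlonglongrightarrow> 0"
        by (rule tendsto_eventually)
    qed
    show "(\<integral>\<^sup>+x. indicator ?H x \<partial>\<mu>) < \<infinity>" using emeasure_cube_finite[of a l] by simp
  qed (use emeasure_cube_finite[of a l] in \<open>auto simp: indicator_def assms(3)\<close>)
  then have "(\<lambda>m. emeasure \<mu> (U' - V m)) \<longlonglongrightarrow> 0" by simp
  then have "(\<lambda>m. 2 * emeasure \<mu> (U' - V m)) \<longlonglongrightarrow> 2 * 0"
    by (intro ennreal_tendsto_cmult) auto
  then have lim: "(\<lambda>m. 2 * emeasure \<mu> (U' - V m)) \<longlonglongrightarrow> 0" by simp
  show ?thesis
    by (rule tendsto_sandwich[OF _ _ tendsto_const lim]) (auto intro!: always_eventually le)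
qed

text \<open>
  Outer regularity of the finite measure obtained by restricting to the cube approximates the
  indicator of a Borel set by that of an open set.
\<close>

lemma dyadic_error_indicator_tendsto:
  assumes "0 < l" "A \<in> sets borel"
  shows "(\<lambda>m. dyadic_error m a l (indicator (A \<inter> half_open_cube a l))) \<longlonglongrightarrow> 0"
proof (rule dyadic_error_tendsto_approx[OF assms(1)])
  let ?H = "half_open_cube a l"
  have [measurable]: "A \<in> sets borel" by fact
  have int: "integrable \<mu> (indicator (B \<inter> ?H) :: _ \<Rightarrow> real)" if "B \<in> sets borel" for B
    using that by (intro integrable_indicator_subset[of _ a l]) auto
  show "integrable \<mu> (indicator (A \<inter> ?H) :: _ \<Rightarrow> real)" by (intro int) simp
  define \<nu> where "\<nu> = density \<mu> (indicator ?H)"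
  have \<nu>: "emeasure \<nu> B = emeasure \<mu> (B \<inter> ?H)" if "B \<in> sets borel" for B
    using that unfolding \<nu>_def by (subst emeasure_density) (auto simp: indicator_inter_arith[symmetric] Int_commute)
  fix e :: real assume "0 < e"
  have "emeasure \<nu> A = (INF U \<in> {U. A \<subseteq> U \<and> open U}. emeasure \<nu> U)"
    using \<nu>[of UNIV] emeasure_cube_finite[of a l] by (intro outer_regular) (auto simp: \<nu>_def)
  moreover have "emeasure \<nu> A < \<infinity>"
    using \<nu>[of A] emeasure_mono[of "A \<inter> ?H" ?H \<mu>] emeasure_cube_finite[of a l] by (auto simp: less_top[symmetric] top_unique)
  ultimately have "(INF U \<in> {U. A \<subseteq> U \<and> open U}. emeasure \<nu> U) < emeasure \<nu> A + ennreal e"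
    using \<open>0 < e\<close> by (metis ennreal_add_left_cancel_less add.right_neutral ennreal_less_zero_iff infinity_ennreal_def order_less_irrefl)
  then obtain U where U: "A \<subseteq> U" "open U" "emeasure \<nu> U < emeasure \<nu> A + ennreal e"
    by (auto simp: INF_less_iff)
  have [measurable]: "U \<in> sets borel" using U by auto
  have "(\<integral>\<^sup>+x\<in>?H. ennreal \<bar>indicator (A \<inter> ?H) x - indicator (U \<inter> ?H) x\<bar> \<partial>\<mu>)
      = (\<integral>\<^sup>+x. indicator (U \<inter> ?H - A \<inter> ?H) x \<partial>\<mu>)"
    using U(1) by (intro nn_integral_cong) (auto simp: indicator_def)
  also have "\<dots> = emeasure \<mu> (U \<inter> ?H - A \<inter> ?H)" by simp
  also have "\<dots> = emeasure \<nu> U - emeasure \<nu> A"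
    using U(1) \<open>emeasure \<nu> A < \<infinity>\<close> by (subst emeasure_Diff) (auto simp: \<nu>)
  also have "\<dots> \<le> ennreal e"
    using U(3) \<open>emeasure \<nu> A < \<infinity>\<close> by (intro ennreal_minus_le_iff[THEN iffD2]) (auto simp: add.commute)
  finally show "\<exists>g. integrable \<mu> g \<and> (\<lambda>m. dyadic_error m a l g) \<longlonglongrightarrow> 0 \<and>
      (\<integral>\<^sup>+x\<in>?H. ennreal \<bar>indicator (A \<inter> ?H) x - g x\<bar> \<partial>\<mu>) \<le> ennreal e"
    using dyadic_error_open_tendsto[OF assms(1) U(2) refl] int[of U]
    by (intro exI[of _ "indicator (U \<inter> ?H)"]) auto
qed

lemma dyadic_error_tendsto:
  assumes "0 < l" and f: "integrable \<mu> f"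
  shows "(\<lambda>m. dyadic_error m a l f) \<longlonglongrightarrow> 0"
  using f
proof induction
  case (base A c)
  let ?H = "half_open_cube a l"
  have "dyadic_error m a l (\<lambda>x. indicator A x *\<^sub>R c)
      = ennreal \<bar>c\<bar> * dyadic_error m a l (indicator (A \<inter> ?H))" for m
  proof -
    have "dyadic_error m a l (\<lambda>x. indicator A x *\<^sub>R c) = dyadic_error m a l (\<lambda>x. c * indicator (A \<inter> ?H) x)"
      using assms(1) by (intro dyadic_error_cong) (auto simp: indicator_def)
    also have "\<dots> = (\<integral>\<^sup>+x. ennreal \<bar>c\<bar> * (ennreal \<bar>dyadic_average \<mu> m a l (indicator (A \<inter> ?H)) x - indicator (A \<inter> ?H) x\<bar> * indicator ?H x) \<partial>\<mu>)"
      unfolding dyadic_error_def dyadic_average_cmult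
      by (intro nn_integral_cong) (simp add: right_diff_distrib[symmetric] abs_mult ennreal_mult mult.assoc)
    also have "\<dots> = ennreal \<bar>c\<bar> * dyadic_error m a l (indicator (A \<inter> ?H))"
      unfolding dyadic_error_def using base by (intro nn_integral_cmult) auto
    finally show ?thesis .
  qed
  moreover have "(\<lambda>m. ennreal \<bar>c\<bar> * dyadic_error m a l (indicator (A \<inter> ?H))) \<longlonglongrightarrow> ennreal \<bar>c\<bar> * 0"
    using assms(1) base by (intro ennreal_tendsto_cmult dyadic_error_indicator_tendsto) auto
  ultimately show ?case by simp
next
  case (add f g)
  have lim: "(\<lambda>m. dyadic_error m a l f + dyadic_error m a l g) \<longlonglongrightarrow> 0"
    using tendsto_add[OF add(3,4)] by simp
  show ?case
    by (rule tendsto_sandwich[OF _ _ tendsto_const lim])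
      (auto intro!: always_eventually dyadic_error_add_le assms(1) add)
next
  case (lim f s)
  show ?case
  proof (rule dyadic_error_tendsto_approx[OF assms(1) lim.hyps(4)])
    fix e :: real assume "0 < e"
    note [measurable] = borel_measurable_integrable[OF lim.hyps(1)] borel_measurable_integrable[OF lim.hyps(4)]
    have "(\<lambda>i. \<integral>\<^sup>+x. norm (f x - s i x) \<partial>\<mu>) \<longlonglongrightarrow> 0"
    proof (rule nn_integral_dominated_convergence_norm)
      show "(\<integral>\<^sup>+x. ennreal (2 * norm (f x)) \<partial>\<mu>) < \<infinity>"
        using integrable_mult_right[OF integrable_norm[OF lim.hyps(4)], of 2]
        unfolding integrable_iff_bounded by simp
    qed (use lim.hyps in auto)
    then have "eventually (\<lambda>i. (\<integral>\<^sup>+x. norm (f x - s i x) \<partial>\<mu>) < ennreal e) sequentially"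
      using \<open>0 < e\<close> by (intro order_tendstoD(2)) auto
    then obtain i where i: "(\<integral>\<^sup>+x. norm (f x - s i x) \<partial>\<mu>) < ennreal e"
      by (auto simp: eventually_sequentially)
    have "(\<integral>\<^sup>+x\<in>half_open_cube a l. ennreal \<bar>f x - s i x\<bar> \<partial>\<mu>) \<le> (\<integral>\<^sup>+x. norm (f x - s i x) \<partial>\<mu>)"
      by (intro nn_integral_mono) (auto simp: indicator_def)
    then show "\<exists>g. integrable \<mu> g \<and> (\<lambda>m. dyadic_error m a l g) \<longlonglongrightarrow> 0 \<and>
        (\<integral>\<^sup>+x\<in>half_open_cube a l. ennreal \<bar>f x - g x\<bar> \<partial>\<mu>) \<le> ennreal e"
      using lim.hyps lim.IH i by (intro exI[of _ "s i"]) auto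
  qed
qed

text \<open>
  Convergence in \<open>L\<^sup>1\<close> is enough for an application of Fatou's lemma, as almost everywhere
  convergence is only needed along a subsequence.
\<close>

lemma dyadic_average_AE_subseq:
  assumes "0 < l" and [measurable]: "f \<in> borel_measurable \<mu>" and f: "set_integrable \<mu> (half_open_cube a l) f"
  shows "\<exists>r. strict_mono r \<and>
    (AE x in \<mu>. x \<in> half_open_cube a l \<longrightarrow> (\<lambda>m. dyadic_average \<mu> (r m) a l f x) \<longlonglongrightarrow> f x)"
proof -
  let ?H = "half_open_cube a l"
  define u where "u m x = indicator ?H x * (dyadic_average \<mu> m a l f x - f x)" for m x
  have [measurable]: "u m \<in> borel_measurable \<mu>" for m
    unfolding u_def by measurable
  have f': "integrable \<mu> (\<lambda>x. indicator ?H x * f x)"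
    using f by (simp add: set_integrable_def)
  have err: "(\<integral>\<^sup>+x. norm (u m x) \<partial>\<mu>) = dyadic_error m a l (\<lambda>x. indicator ?H x * f x)" for m
  proof -
    have "(\<integral>\<^sup>+x. norm (u m x) \<partial>\<mu>) = dyadic_error m a l f"
      unfolding dyadic_error_def u_def by (intro nn_integral_cong) (simp add: indicator_def)
    also have "\<dots> = dyadic_error m a l (\<lambda>x. indicator ?H x * f x)"
      using assms(1) by (intro dyadic_error_cong) auto
    finally show ?thesis .
  qed
  have "dyadic_error m a l (\<lambda>x. indicator ?H x * f x) < \<infinity>" for m
  proof -
    have "dyadic_error m a l (\<lambda>x. indicator ?H x * f x) \<le> 2 * (\<integral>\<^sup>+x\<in>?H. ennreal \<bar>indicator ?H x * f x\<bar> \<partial>\<mu>)"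
      using assms(1) f' by (rule dyadic_error_le)
    also have "(\<integral>\<^sup>+x\<in>?H. ennreal \<bar>indicator ?H x * f x\<bar> \<partial>\<mu>) = (\<integral>\<^sup>+x. norm (indicator ?H x * f x) \<partial>\<mu>)"
      by (intro nn_integral_cong) (simp add: indicator_def)
    also have "2 * \<dots> < \<infinity>"
      using f' by (simp add: integrable_iff_bounded ennreal_mult_less_top)
    finally show ?thesis .
  qed
  then have int: "integrable \<mu> (u m)" for m
    by (simp only: integrable_iff_bounded err) simp
  have "(\<lambda>m. \<integral>\<^sup>+x. norm (u m x) \<partial>\<mu>) \<longlonglongrightarrow> 0"
    unfolding err using assms(1) f' by (rule dyadic_error_tendsto)
  then have "(\<lambda>m. ennreal (\<integral>x. norm (u m x) \<partial>\<mu>)) \<longlonglongrightarrow> ennreal 0"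
    using int by (simp add: nn_integral_eq_integral)
  then have "(\<lambda>m. \<integral>x. norm (u m x) \<partial>\<mu>) \<longlonglongrightarrow> 0"
    by (subst (asm) tendsto_ennreal_iff) auto
  then obtain r where r: "strict_mono r" "AE x in \<mu>. (\<lambda>m. u (r m) x) \<longlonglongrightarrow> 0"
    using tendsto_L1_AE_subseq[of \<mu> u, OF int] by blast
  have "AE x in \<mu>. x \<in> ?H \<longrightarrow> (\<lambda>m. dyadic_average \<mu> (r m) a l f x) \<longlonglongrightarrow> f x"
    using r(2)
  proof eventually_elim
    case (elim x)
    then show ?case
      by (auto simp: u_def LIM_zero_iff)
  qed
  with r(1) show ?thesis by blast
qed

end

section \<open>Self-improvement of the mean oscillation\<close>

lemma convex_combination_ennreal:
  fixes M :: ennreal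
  assumes "0 \<le> \<theta>" "\<theta> \<le> 1" "0 < B"
  shows "ennreal \<theta> * M + ennreal ((1 - \<theta>) / B) * (ennreal B * M) = M"
proof -
  have "ennreal \<theta> * M + ennreal ((1 - \<theta>) / B) * (ennreal B * M)
      = (ennreal \<theta> + ennreal ((1 - \<theta>) / B * B)) * M"
    using assms by (subst ennreal_mult) (auto simp: distrib_right mult.assoc)
  also have "ennreal \<theta> + ennreal ((1 - \<theta>) / B * B) = 1"
    using assms by (simp flip: ennreal_plus)
  finally show ?thesis by simp
qed

locale dyadic_bmo = half_open_cube_measure \<mu> for \<mu> :: "(real ^ 'n) measure" +
  fixes f :: "real ^ 'n \<Rightarrow> real" and C B :: real
  assumes C_ge_1: "1 \<le> C" and B_pos: "0 < B"
    and borel_measurable_f [measurable]: "f \<in> borel_measurable borel"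
    and integrable_f: "set_integrable \<mu> (half_open_cube a l) f"
    and doubling: "0 < l \<Longrightarrow>
      emeasure \<mu> (half_open_cube a l) \<le> ennreal C * emeasure \<mu> (half_open_cube (corner a l x) (l / 2))"
    and oscillation_le: "0 < l \<Longrightarrow>
      (\<integral>\<^sup>+x\<in>half_open_cube a l. ennreal \<bar>f x - average \<mu> (half_open_cube a l) f\<bar> \<partial>\<mu>)
        \<le> ennreal B * emeasure \<mu> (half_open_cube a l)"
begin

lemma borel_measurable_young_fun [measurable]: "young_fun p \<alpha> \<in> borel_measurable borel"
  unfolding young_fun_def by measurable

lemma cube_mult_le_cancel:
  assumes "0 < l" "ennreal s * emeasure \<mu> (half_open_cube a l) \<le> ennreal k * emeasure \<mu> (half_open_cube a l)"
    "0 \<le> k"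
  shows "s \<le> k"
proof -
  have "emeasure \<mu> (half_open_cube a l) = ennreal (measure \<mu> (half_open_cube a l))"
    using emeasure_cube_finite[of a l] by (simp add: emeasure_eq_ennreal_measure less_top)
  then show ?thesis
    using assms measure_cube_pos[OF assms(1), of a]
    by (cases "0 \<le> s") (auto simp flip: ennreal_mult)
qed

text \<open>
  This is the stopping argument in a form that proceeds one generation at a time. The right-hand side
  is additive over the children of the cube, so it is enough to treat each child \<open>K\<close> separately.
  
  If the mean of \<open>\<bar>f - c\<bar>\<close> over \<open>K\<close> is still at most \<open>e B\<close>, the induction hypothesis applies with the same
  \<open>c\<close>. Otherwise \<open>K\<close> is a stopping cube: its parent has a mean of at most \<open>e B\<close>, so doubling gives
  \<open>\<bar>f\<^sub>K - c\<bar> \<le> C e B = \<theta> t\<close>, and the induction hypothesis is applied with \<open>f\<^sub>K\<close> in place of \<open>c\<close>. The change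
  of constant costs \<open>\<theta> \<mu> K + (1 - \<theta>) e \<mu> K\<close> by \<open>young_fun_shift\<close>, and the second term is paid for by
  \<open>e B \<mu> K < \<integral>\<^sub>K \<bar>f - c\<bar>\<close>, which expresses that \<open>K\<close> was stopped.
\<close>

lemma young_dyadic_average_le:
  fixes p \<alpha> \<theta> t c :: real
  assumes "1 \<le> p" "0 \<le> \<alpha>" and \<theta>: "\<theta> = 1 / (p + \<alpha> + 1)"
    and t: "0 < t" "C * (exp 1 * B) = \<theta> * t"
    and "0 < l"
    and "(\<integral>\<^sup>+x\<in>half_open_cube a l. ennreal \<bar>f x - c\<bar> \<partial>\<mu>)
      \<le> ennreal (exp 1 * B) * emeasure \<mu> (half_open_cube a l)"
  shows "(\<integral>\<^sup>+x\<in>half_open_cube a l. ennreal (young_fun p \<alpha> (\<bar>dyadic_average \<mu> m a l f x - c\<bar> / t)) \<partial>\<mu>)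
    \<le> ennreal \<theta> * emeasure \<mu> (half_open_cube a l)
      + ennreal ((1 - \<theta>) / B) * (\<integral>\<^sup>+x\<in>half_open_cube a l. ennreal \<bar>f x - c\<bar> \<partial>\<mu>)"
  using assms(6,7)
proof (induction m arbitrary: a l c)
  case (0 a l c)
  let ?H = "half_open_cube a l"
  let ?s = "\<bar>average \<mu> ?H f - c\<bar>"
  have "ennreal ?s * emeasure \<mu> ?H \<le> ennreal (exp 1 * B) * emeasure \<mu> ?H"
    using average_diff_cube_le[OF 0(1) integrable_f, of a c] 0(2) by (rule order_trans)
  then have "?s \<le> 1 * (exp 1 * B)"
    using cube_mult_le_cancel[OF 0(1)] B_pos by simp
  also have "\<dots> \<le> \<theta> * t"
    unfolding t(2)[symmetric] using C_ge_1 B_pos by (intro mult_right_mono) auto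
  finally have "young_fun p \<alpha> (?s / t) \<le> young_fun p \<alpha> \<theta>"
    using assms(1,2) t by (intro young_fun_mono) (auto simp: field_simps)
  also have "\<dots> \<le> \<theta>"
    using young_fun_shift[OF assms(1,2) order_refl \<theta>] by (simp add: young_fun_0)
  finally have "(\<integral>\<^sup>+x\<in>?H. ennreal (young_fun p \<alpha> (\<bar>dyadic_average \<mu> 0 a l f x - c\<bar> / t)) \<partial>\<mu>)
      \<le> ennreal \<theta> * emeasure \<mu> ?H"
    by (simp add: dyadic_average_def nn_integral_cmult_indicator mult_right_mono ennreal_leI)
  then show ?case
    by (rule order_trans) simp
next
  case (Suc m a l c)
  let ?H = "half_open_cube a l"
  let ?K = "\<lambda>b. half_open_cube b (l / 2)"
  let ?I = "\<lambda>A. \<integral>\<^sup>+x\<in>A. ennreal \<bar>f x - c\<bar> \<partial>\<mu>"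
  let ?Y = "\<lambda>b c. \<integral>\<^sup>+x\<in>?K b. ennreal (young_fun p \<alpha> (\<bar>dyadic_average \<mu> m b (l / 2) f x - c\<bar> / t)) \<partial>\<mu>"
  have \<theta>': "0 < \<theta>" "\<theta> < 1" using assms(1-3) by auto
  have l2: "0 < l / 2" using Suc.prems by simp
  have child: "?Y b c \<le> ennreal \<theta> * emeasure \<mu> (?K b) + ennreal ((1 - \<theta>) / B) * ?I (?K b)"
    if b: "b \<in> range (corner a l)" for b
  proof (cases "?I (?K b) \<le> ennreal (exp 1 * B) * emeasure \<mu> (?K b)")
    case True
    then show ?thesis using l2 by (intro Suc.IH)
  next
    case False
    let ?g = "average \<mu> (?K b) f"
    have "ennreal \<bar>?g - c\<bar> * emeasure \<mu> (?K b) \<le> ?I (?K b)"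
      by (intro average_diff_cube_le l2 integrable_f)
    also have "\<dots> \<le> ?I ?H"
      using half_open_cube_corner_subset[OF Suc.prems(1)] b
      by (intro nn_integral_mono mult_left_mono indicator_leI) auto
    also have "\<dots> \<le> ennreal (exp 1 * B) * emeasure \<mu> ?H"
      by (rule Suc.prems)
    also have "\<dots> \<le> ennreal (exp 1 * B) * (ennreal C * emeasure \<mu> (?K b))"
      using b doubling[OF Suc.prems(1)] by (intro mult_left_mono) auto
    also have "\<dots> = ennreal (\<theta> * t) * emeasure \<mu> (?K b)"
      unfolding t(2)[symmetric] using B_pos C_ge_1 by (simp add: ennreal_mult mult_ac)
    finally have gc: "\<bar>?g - c\<bar> \<le> \<theta> * t"
      using cube_mult_le_cancel[OF l2] \<theta>' t by simp
    \<comment> \<open>Restart at the stopping cube: with \<open>c\<close> its own average, the bound of the claim collapses to its mass.\<close>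
    have "?Y b ?g \<le> ennreal \<theta> * emeasure \<mu> (?K b)
        + ennreal ((1 - \<theta>) / B) * (\<integral>\<^sup>+x\<in>?K b. ennreal \<bar>f x - ?g\<bar> \<partial>\<mu>)"
    proof (intro Suc.IH l2 order_trans[OF oscillation_le[OF l2]] mult_right_mono ennreal_leI)
      show "B \<le> exp 1 * B"
        using B_pos by simp
    qed simp
    also have "\<dots> \<le> ennreal \<theta> * emeasure \<mu> (?K b) + ennreal ((1 - \<theta>) / B) * (ennreal B * emeasure \<mu> (?K b))"
      by (intro add_left_mono mult_left_mono oscillation_le l2) simp
    also have "\<dots> = emeasure \<mu> (?K b)"
      using B_pos \<theta>' by (intro convex_combination_ennreal) auto
    finally have Yg: "?Y b ?g \<le> emeasure \<mu> (?K b)" .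
    have "?Y b c \<le> (\<integral>\<^sup>+x\<in>?K b. (ennreal \<theta> + ennreal ((1 - \<theta>) * exp 1) *
        ennreal (young_fun p \<alpha> (\<bar>dyadic_average \<mu> m b (l / 2) f x - ?g\<bar> / t))) \<partial>\<mu>)"
    proof (intro nn_integral_mono mult_right_mono)
      fix x
      let ?d = "dyadic_average \<mu> m b (l / 2) f x"
      have "\<bar>?d - c\<bar> \<le> \<theta> * t + \<bar>?d - ?g\<bar>" using gc by linarith
      then have "\<bar>?d - c\<bar> / t \<le> \<theta> + \<bar>?d - ?g\<bar> / t"
        using t by (simp add: field_simps)
      then have "young_fun p \<alpha> (\<bar>?d - c\<bar> / t) \<le> young_fun p \<alpha> (\<theta> + \<bar>?d - ?g\<bar> / t)"
        using assms(1,2) t by (intro young_fun_mono) auto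
      also have "\<dots> \<le> \<theta> + (1 - \<theta>) * (exp 1 * young_fun p \<alpha> (\<bar>?d - ?g\<bar> / t))"
        using assms(1,2) t by (intro young_fun_shift \<theta>) auto
      finally have "ennreal (young_fun p \<alpha> (\<bar>?d - c\<bar> / t))
          \<le> ennreal (\<theta> + ((1 - \<theta>) * exp 1) * young_fun p \<alpha> (\<bar>?d - ?g\<bar> / t))"
        by (intro ennreal_leI) (simp add: mult.assoc)
      also have "\<dots> = ennreal \<theta> + ennreal ((1 - \<theta>) * exp 1) * ennreal (young_fun p \<alpha> (\<bar>?d - ?g\<bar> / t))"
        using \<theta>' by (subst ennreal_plus) (auto simp: young_fun_nonneg ennreal_mult)
      finally show "ennreal (young_fun p \<alpha> (\<bar>?d - c\<bar> / t))
          \<le> ennreal \<theta> + ennreal ((1 - \<theta>) * exp 1) * ennreal (young_fun p \<alpha> (\<bar>?d - ?g\<bar> / t))" .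
    qed simp
    also have "\<dots> = ennreal \<theta> * emeasure \<mu> (?K b) + ennreal ((1 - \<theta>) * exp 1) * ?Y b ?g"
      by (simp add: distrib_right nn_integral_add nn_integral_cmult nn_integral_cmult_indicator mult.assoc)
    also have "\<dots> \<le> ennreal \<theta> * emeasure \<mu> (?K b) + ennreal ((1 - \<theta>) * exp 1) * emeasure \<mu> (?K b)"
      by (intro add_left_mono mult_left_mono Yg) simp
    also have "(1 - \<theta>) * exp 1 = (1 - \<theta>) / B * (exp 1 * B)"
      using B_pos by simp
    also have "ennreal ((1 - \<theta>) / B * (exp 1 * B)) * emeasure \<mu> (?K b)
        = ennreal ((1 - \<theta>) / B) * (ennreal (exp 1 * B) * emeasure \<mu> (?K b))"
      using B_pos \<theta>' by (subst ennreal_mult) (auto simp: mult.assoc)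
    also have "ennreal \<theta> * emeasure \<mu> (?K b) + \<dots> \<le> ennreal \<theta> * emeasure \<mu> (?K b) + ennreal ((1 - \<theta>) / B) * ?I (?K b)"
      using False by (intro add_left_mono mult_left_mono) auto
    finally show ?thesis .
  qed
  have "(\<integral>\<^sup>+x\<in>?H. ennreal (young_fun p \<alpha> (\<bar>dyadic_average \<mu> (Suc m) a l f x - c\<bar> / t)) \<partial>\<mu>)
      = (\<Sum>b\<in>range (corner a l). ?Y b c)"
    by (intro nn_integral_dyadic_average_Suc[where u = "\<lambda>s. ennreal (young_fun p \<alpha> (\<bar>s - c\<bar> / t))"] Suc.prems(1)) simp
  also have "\<dots> \<le> (\<Sum>b\<in>range (corner a l).
      ennreal \<theta> * emeasure \<mu> (?K b) + ennreal ((1 - \<theta>) / B) * ?I (?K b))"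
    by (intro sum_mono child)
  also have "\<dots> = ennreal \<theta> * (\<Sum>b\<in>range (corner a l). emeasure \<mu> (?K b))
      + ennreal ((1 - \<theta>) / B) * (\<Sum>b\<in>range (corner a l). ?I (?K b))"
    by (simp add: sum.distrib sum_distrib_left)
  also have "(\<Sum>b\<in>range (corner a l). ?I (?K b)) = ?I ?H"
    by (intro nn_integral_half_open_cube_split[symmetric] Suc.prems(1)) auto
  also have "(\<Sum>b\<in>range (corner a l). emeasure \<mu> (?K b)) = emeasure \<mu> ?H"
    using nn_integral_half_open_cube_split[OF Suc.prems(1) sets_eq, of "\<lambda>_. 1" a] by simp
  finally show ?case .
qed

lemma young_average_le:
  fixes p \<alpha> t :: real
  assumes "1 \<le> p" "0 \<le> \<alpha>" and t: "t = C * exp 1 * (p + \<alpha> + 1) * B" and "0 < l"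
  shows "(\<integral>\<^sup>+x\<in>half_open_cube a l.
      ennreal (young_fun p \<alpha> (\<bar>f x - average \<mu> (half_open_cube a l) f\<bar> / t)) \<partial>\<mu>)
    \<le> emeasure \<mu> (half_open_cube a l)"
proof -
  let ?H = "half_open_cube a l"
  define c where "c = average \<mu> ?H f"
  define \<theta> where "\<theta> = 1 / (p + \<alpha> + 1)"
  have \<theta>: "0 < \<theta>" "\<theta> < 1" using assms(1,2) by (auto simp: \<theta>_def)
  have "p + \<alpha> + 1 \<noteq> 0" using assms(1,2) by auto
  then have t': "0 < t" "C * (exp 1 * B) = \<theta> * t"
    using C_ge_1 B_pos assms(1,2) by (auto simp: \<theta>_def t)
  have osc: "(\<integral>\<^sup>+x\<in>?H. ennreal \<bar>f x - c\<bar> \<partial>\<mu>) \<le> ennreal B * emeasure \<mu> ?H"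
    unfolding c_def by (rule oscillation_le[OF assms(4)])
  also have "\<dots> \<le> ennreal (exp 1 * B) * emeasure \<mu> ?H"
    using B_pos by (intro mult_right_mono ennreal_leI) auto
  finally have osc': "(\<integral>\<^sup>+x\<in>?H. ennreal \<bar>f x - c\<bar> \<partial>\<mu>) \<le> ennreal (exp 1 * B) * emeasure \<mu> ?H" .
  define Y where "Y m x = ennreal (young_fun p \<alpha> (\<bar>dyadic_average \<mu> m a l f x - c\<bar> / t)) * indicator ?H x" for m x
  have Y_meas: "Y m \<in> borel_measurable \<mu>" for m
    unfolding Y_def by measurable
  have Y_le: "integral\<^sup>N \<mu> (Y m) \<le> emeasure \<mu> ?H" for m
  proof -
    have "integral\<^sup>N \<mu> (Y m) \<le> ennreal \<theta> * emeasure \<mu> ?H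
        + ennreal ((1 - \<theta>) / B) * (\<integral>\<^sup>+x\<in>?H. ennreal \<bar>f x - c\<bar> \<partial>\<mu>)"
      unfolding Y_def by (rule young_dyadic_average_le[OF assms(1,2) \<theta>_def t' assms(4) osc'])
    also have "\<dots> \<le> ennreal \<theta> * emeasure \<mu> ?H + ennreal ((1 - \<theta>) / B) * (ennreal B * emeasure \<mu> ?H)"
      by (intro add_left_mono mult_left_mono osc) simp
    also have "\<dots> = emeasure \<mu> ?H"
      using B_pos \<theta> by (intro convex_combination_ennreal) auto
    finally show ?thesis .
  qed
  obtain r where r: "strict_mono r"
    "AE x in \<mu>. x \<in> ?H \<longrightarrow> (\<lambda>m. dyadic_average \<mu> (r m) a l f x) \<longlonglongrightarrow> f x"
    using dyadic_average_AE_subseq[OF assms(4) _ integrable_f] by auto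
  have "(\<integral>\<^sup>+x\<in>?H. ennreal (young_fun p \<alpha> (\<bar>f x - c\<bar> / t)) \<partial>\<mu>) \<le> (\<integral>\<^sup>+x. liminf (\<lambda>m. Y (r m) x) \<partial>\<mu>)"
  proof (rule nn_integral_mono_AE, use r(2) in eventually_elim)
    fix x assume x: "x \<in> ?H \<longrightarrow> (\<lambda>m. dyadic_average \<mu> (r m) a l f x) \<longlonglongrightarrow> f x"
    show "ennreal (young_fun p \<alpha> (\<bar>f x - c\<bar> / t)) * indicator ?H x \<le> liminf (\<lambda>m. Y (r m) x)"
    proof (cases "x \<in> ?H")
      case True
      have "(\<lambda>m. young_fun p \<alpha> (\<bar>dyadic_average \<mu> (r m) a l f x - c\<bar> / t))
          \<longlonglongrightarrow> young_fun p \<alpha> (\<bar>f x - c\<bar> / t)"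
        using x True t' assms(1)
        by (intro continuous_on_tendsto_compose[OF continuous_on_young_fun] tendsto_intros) auto
      then have "(\<lambda>m. Y (r m) x) \<longlonglongrightarrow> ennreal (young_fun p \<alpha> (\<bar>f x - c\<bar> / t)) * indicator ?H x"
        using True by (simp add: Y_def tendsto_ennrealI)
      then show ?thesis
        by (simp add: lim_imp_Liminf)
    qed simp
  qed
  also have "\<dots> \<le> liminf (\<lambda>m. integral\<^sup>N \<mu> (Y (r m)))"
    by (intro nn_integral_liminf Y_meas)
  also have "\<dots> \<le> emeasure \<mu> ?H"
    by (intro Liminf_le always_eventually allI Y_le) auto
  finally show ?thesis unfolding c_def .
qed

end

section \<open>From half-open to closed cubes\<close>

lemma doubling_measureD:
  assumes "doubling_measure \<mu> c d"
  shows "sets \<mu> = sets borel" "emeasure \<mu> (space \<mu>) \<noteq> 0" "locally_finite_measure \<mu>" "1 \<le> c" "0 < d"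
    and "0 < l \<Longrightarrow> 0 < m \<Longrightarrow> cube a l \<subseteq> cube b m \<Longrightarrow>
      emeasure \<mu> (cube b m) \<le> ennreal (c * (m / l) powr d) * emeasure \<mu> (cube a l)"
  using assms unfolding doubling_measure_def by simp_all

lemma emeasure_compact_finite:
  assumes "locally_finite_measure \<mu>" "sets \<mu> = sets borel" "compact K"
  shows "emeasure \<mu> K < \<infinity>"
proof -
  obtain U where U: "\<And>x. open (U x)" "\<And>x. x \<in> U x" "\<And>x. emeasure \<mu> (U x) < \<infinity>"
    using assms(1) unfolding locally_finite_measure_def by metis
  obtain F where F: "F \<subseteq> K" "finite F" "K \<subseteq> (\<Union>x\<in>F. U x)"
    using compactE_image[OF assms(3), of K U] U(1,2) by blast
  have "emeasure \<mu> K \<le> emeasure \<mu> (\<Union>x\<in>F. U x)"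
    using F U assms(2) by (intro emeasure_mono) auto
  also have "\<dots> \<le> (\<Sum>x\<in>F. emeasure \<mu> (U x))"
    using F U assms(2) by (intro emeasure_subadditive_finite) auto
  also have "\<dots> < \<infinity>"
    using U(3) F(2) by (simp add: less_top)
  finally show ?thesis .
qed

text \<open>
  The function is the pointwise limit of its restrictions to the balls of integer radius around
  \<open>undefined\<close>, which serves as an arbitrary centre.
\<close>

lemma locally_integrable_borel_measurable:
  fixes f :: "'a :: heine_borel \<Rightarrow> real"
  assumes "locally_integrable \<mu> f" "sets \<mu> = sets borel"
  shows "f \<in> borel_measurable borel"
proof (rule borel_measurable_LIMSEQ_real)
  fix k :: nat
  have "set_integrable \<mu> (cball undefined (real k)) f"
    using assms(1) by (simp add: locally_integrable_def)
  then have "(\<lambda>x. indicator (cball undefined (real k)) x * f x) \<in> borel_measurable \<mu>"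
    by (simp add: set_integrable_def borel_measurable_integrable)
  then show "(\<lambda>x. indicator (cball undefined (real k)) x * f x) \<in> borel_measurable borel"
    using assms(2) by (simp cong: measurable_cong_sets)
next
  fix x :: 'a
  obtain k0 where k0: "dist undefined x \<le> real k0"
    using real_arch_simple by blast
  have "eventually (\<lambda>k. indicator (cball undefined (real k)) x * f x = f x) sequentially"
    using eventually_ge_at_top[of k0] by eventually_elim (use k0 in \<open>auto simp: indicator_def\<close>)
  then show "(\<lambda>k. indicator (cball undefined (real k)) x * f x) \<longlonglongrightarrow> f x"
    by (rule tendsto_eventually)
qed

lemma
  fixes f :: "'a \<Rightarrow> real"
  assumes K: "emeasure \<mu> K < \<infinity>" "set_integrable \<mu> K f" "K \<in> sets \<mu>"
    and S: "\<And>k. S k \<in> sets \<mu>" "\<And>k. S k \<subseteq> K" "T \<in> sets \<mu>"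
    and lim: "\<And>x. eventually (\<lambda>k. x \<in> S k \<longleftrightarrow> x \<in> T) sequentially"
  shows measure_tendsto_of_eventually_mem: "(\<lambda>k. measure \<mu> (S k)) \<longlonglongrightarrow> measure \<mu> T"
    and average_tendsto_of_eventually_mem:
      "0 < measure \<mu> T \<Longrightarrow> (\<lambda>k. average \<mu> (S k) f) \<longlonglongrightarrow> average \<mu> T f"
proof -
  have ind: "(\<lambda>k. indicator (S k) x * h :: real) \<longlonglongrightarrow> indicator T x * h" for x h
    using lim[of x] by (intro tendsto_eventually) (auto elim!: eventually_mono simp: indicator_def)
  have gen: "(\<lambda>k. LINT x|\<mu>. indicator (S k) x * h x) \<longlonglongrightarrow> (LINT x|\<mu>. indicator T x * h x)"
    if h: "set_integrable \<mu> K h" "h = f \<or> h = (\<lambda>_. 1)" for h :: "'a \<Rightarrow> real"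
  proof (rule integral_dominated_convergence)
    show "integrable \<mu> (\<lambda>x. \<bar>indicator K x * h x\<bar>)"
      using h by (simp add: set_integrable_def)
    have meas: "(\<lambda>x. indicator A x * h x) \<in> borel_measurable \<mu>" if "A \<in> sets \<mu>" "A \<subseteq> K" for A
      using set_integrable_subset[OF h(1) that] by (simp add: set_integrable_def)
    show "(\<lambda>x. indicator (S k) x * h x) \<in> borel_measurable \<mu>" for k
      using S by (intro meas)
    have "T \<subseteq> K"
    proof
      fix x assume "x \<in> T"
      then obtain k where "x \<in> S k"
        using lim[of x] by (auto simp: eventually_sequentially)
      then show "x \<in> K" using S by auto
    qed
    then show "(\<lambda>x. indicator T x * h x) \<in> borel_measurable \<mu>"
      using S by (intro meas)
    show "AE x in \<mu>. (\<lambda>k. indicator (S k) x * h x) \<longlonglongrightarrow> indicator T x * h x"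
      by (intro AE_I2 ind)
    show "AE x in \<mu>. norm (indicator (S k) x * h x) \<le> \<bar>indicator K x * h x\<bar>" for k
      using S(2)[of k] by (intro AE_I2) (auto simp: indicator_def)
  qed
  have one: "set_integrable \<mu> K (\<lambda>_. 1 :: real)"
    using K by (simp add: set_integrable_def)
  have "measure \<mu> A = (LINT x|\<mu>. indicator A x * 1)" if "A \<in> sets \<mu>" for A
    using that by simp
  then show m: "(\<lambda>k. measure \<mu> (S k)) \<longlonglongrightarrow> measure \<mu> T"
    using gen[OF one] S by simp
  assume "0 < measure \<mu> T"
  then show "(\<lambda>k. average \<mu> (S k) f) \<longlonglongrightarrow> average \<mu> T f"
    unfolding average_def set_lebesgue_integral_def real_scaleR_def
    using m gen[OF K(2)] by (intro tendsto_divide) auto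
qed

text \<open>
  If sets \<open>S k\<close> converge to \<open>T\<close> pointwise and inside a set of finite measure, their masses and the
  averages over them converge, so Fatou's lemma carries a bound on the mean of \<open>g \<bar>f - f\<^bsub>S k\<^esub>\<bar>\<close> over to
  \<open>T\<close>. It is applied with \<open>g\<close> the identity to pass from closed to half-open cubes, and with the
  rescaled Young function to pass back.
\<close>

lemma oscillation_le_of_eventually_mem:
  fixes f :: "'a \<Rightarrow> real" and g :: "real \<Rightarrow> real"
  assumes K: "emeasure \<mu> K < \<infinity>" "set_integrable \<mu> K f" "K \<in> sets \<mu>"
    and S: "\<And>k. S k \<in> sets \<mu>" "\<And>k. S k \<subseteq> K" "T \<in> sets \<mu>"
    and lim: "\<And>x. eventually (\<lambda>k. x \<in> S k \<longleftrightarrow> x \<in> T) sequentially"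
    and pos: "0 < measure \<mu> T" and fin: "emeasure \<mu> T < \<infinity>"
    and f [measurable]: "f \<in> borel_measurable \<mu>"
    and g [measurable]: "g \<in> borel_measurable borel" and cont: "continuous_on {0..} g"
    and "0 \<le> b"
    and le: "\<And>k. (\<integral>\<^sup>+x\<in>S k. ennreal (g \<bar>f x - average \<mu> (S k) f\<bar>) \<partial>\<mu>) \<le> ennreal b * emeasure \<mu> (S k)"
  shows "(\<integral>\<^sup>+x\<in>T. ennreal (g \<bar>f x - average \<mu> T f\<bar>) \<partial>\<mu>) \<le> ennreal b * emeasure \<mu> T"
proof -
  have m: "(\<lambda>k. measure \<mu> (S k)) \<longlonglongrightarrow> measure \<mu> T"
    by (rule measure_tendsto_of_eventually_mem[OF K S lim])
  have avg: "(\<lambda>k. average \<mu> (S k) f) \<longlonglongrightarrow> average \<mu> T f"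
    by (rule average_tendsto_of_eventually_mem[OF K S lim pos])
  have em: "ennreal b * emeasure \<mu> A = ennreal (b * measure \<mu> A)" if "emeasure \<mu> A < \<infinity>" for A
    using that \<open>0 \<le> b\<close> by (simp add: emeasure_eq_ennreal_measure ennreal_mult less_top)
  have Sfin: "emeasure \<mu> (S k) < \<infinity>" for k
    using emeasure_mono[OF S(2) K(3)] K(1) by (rule le_less_trans)
  note [measurable] = S(1,3)
  have "(\<integral>\<^sup>+x\<in>T. ennreal (g \<bar>f x - average \<mu> T f\<bar>) \<partial>\<mu>)
      \<le> (\<integral>\<^sup>+x. liminf (\<lambda>k. ennreal (g \<bar>f x - average \<mu> (S k) f\<bar>) * indicator (S k) x) \<partial>\<mu>)"
  proof (rule nn_integral_mono)
    fix x
    show "ennreal (g \<bar>f x - average \<mu> T f\<bar>) * indicator T x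
        \<le> liminf (\<lambda>k. ennreal (g \<bar>f x - average \<mu> (S k) f\<bar>) * indicator (S k) x)"
    proof (cases "x \<in> T")
      case True
      have "(\<lambda>k. ennreal (g \<bar>f x - average \<mu> (S k) f\<bar>)) \<longlonglongrightarrow> ennreal (g \<bar>f x - average \<mu> T f\<bar>)"
        by (intro tendsto_ennrealI continuous_on_tendsto_compose[OF cont] tendsto_intros avg) auto
      moreover have "eventually (\<lambda>k. ennreal (g \<bar>f x - average \<mu> (S k) f\<bar>)
          = ennreal (g \<bar>f x - average \<mu> (S k) f\<bar>) * indicator (S k) x) sequentially"
        using lim[of x] by eventually_elim (use True in auto)
      ultimately have "(\<lambda>k. ennreal (g \<bar>f x - average \<mu> (S k) f\<bar>) * indicator (S k) x)
          \<longlonglongrightarrow> ennreal (g \<bar>f x - average \<mu> T f\<bar>)"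
        by (rule Lim_transform_eventually)
      then show ?thesis
        using True by (simp add: lim_imp_Liminf)
    qed simp
  qed
  also have "\<dots> \<le> liminf (\<lambda>k. \<integral>\<^sup>+x\<in>S k. ennreal (g \<bar>f x - average \<mu> (S k) f\<bar>) \<partial>\<mu>)"
    by (intro nn_integral_liminf) measurable
  also have "\<dots> \<le> liminf (\<lambda>k. ennreal (b * measure \<mu> (S k)))"
    using le Sfin by (intro Liminf_mono always_eventually) (simp add: em)
  also have "\<dots> = ennreal (b * measure \<mu> T)"
    by (intro lim_imp_Liminf tendsto_ennrealI tendsto_intros m) simp
  also have "\<dots> = ennreal b * emeasure \<mu> T"
    using fin by (simp add: em)
  finally show ?thesis .
qed

lemma mem_cube_iff: "x \<in> cube a l \<longleftrightarrow> (\<forall>i. a $ i \<le> x $ i \<and> x $ i \<le> a $ i + l)"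
  by (simp add: cube_def mem_box_cart)

lemma half_open_cube_subset_cube: "half_open_cube a l \<subseteq> cube a l"
proof
  fix x assume "x \<in> half_open_cube a l"
  then have "a $ i \<le> x $ i \<and> x $ i \<le> a $ i + l" for i
    unfolding half_open_cube_def by (auto dest: spec[of _ i])
  then show "x \<in> cube a l"
    by (simp add: mem_cube_iff)
qed

lemma compact_cube: "compact (cube a l)"
  by (simp add: cube_def)

lemma cube_borel: "cube a l \<in> sets borel"
  by (simp add: cube_def)

lemma small_null_sequence:
  obtains e :: "nat \<Rightarrow> real" where "e \<longlonglongrightarrow> 0" "\<And>k. 0 < e k" "\<And>k. e k < 1 / 2"
proof
  show "(\<lambda>k. inverse (real (Suc k)) / 3) \<longlonglongrightarrow> 0"
    using tendsto_divide[OF LIMSEQ_inverse_real_of_nat tendsto_const[of 3]] by simp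
  show "0 < inverse (real (Suc k)) / 3" "inverse (real (Suc k)) / 3 < 1 / 2" for k
    by (simp_all add: field_simps)
qed

lemma cube_eventually_half_open_cube:
  assumes "0 < l" "e \<longlonglongrightarrow> 0" "\<And>k. 0 < e k"
  shows "eventually (\<lambda>k. x \<in> cube a (l * (1 - e k)) \<longleftrightarrow> x \<in> half_open_cube a l) sequentially"
proof -
  have lim: "(\<lambda>k. a $ i + l * (1 - e k)) \<longlonglongrightarrow> a $ i + l * (1 - 0)" for i
    by (intro tendsto_intros assms)
  have "eventually (\<lambda>k. x $ i < a $ i + l \<longrightarrow> x $ i < a $ i + l * (1 - e k)) sequentially" for i
    using order_tendstoD(1)[OF lim, of "x $ i" i] by (cases "x $ i < a $ i + l") auto
  then have "eventually (\<lambda>k. \<forall>i. x $ i < a $ i + l \<longrightarrow> x $ i < a $ i + l * (1 - e k)) sequentially"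
    by (rule eventually_all_finite)
  then show ?thesis
  proof eventually_elim
    case (elim k)
    have "l * (1 - e k) < l"
      using assms(1,3) by simp
    then have "x $ i \<le> a $ i + l * (1 - e k) \<longleftrightarrow> x $ i < a $ i + l" for i
      using elim by (smt (verit))
    then show ?case
      by (simp add: mem_cube_iff half_open_cube_def)
  qed
qed

lemma half_open_cube_eventually_cube:
  assumes "0 < l" "e \<longlonglongrightarrow> 0" "\<And>k. 0 < e k"
  shows "eventually (\<lambda>k. x \<in> half_open_cube a (l * (1 + e k)) \<longleftrightarrow> x \<in> cube a l) sequentially"
proof -
  have lim: "(\<lambda>k. a $ i + l * (1 + e k)) \<longlonglongrightarrow> a $ i + l * (1 + 0)" for i
    by (intro tendsto_intros assms)
  have "eventually (\<lambda>k. a $ i + l < x $ i \<longrightarrow> a $ i + l * (1 + e k) < x $ i) sequentially" for i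
    using order_tendstoD(2)[OF lim, of i "x $ i"] by (cases "a $ i + l < x $ i") auto
  then have "eventually (\<lambda>k. \<forall>i. a $ i + l < x $ i \<longrightarrow> a $ i + l * (1 + e k) < x $ i) sequentially"
    by (rule eventually_all_finite)
  then show ?thesis
  proof eventually_elim
    case (elim k)
    have "l < l * (1 + e k)"
      using assms(1,3) by simp
    then have "x $ i < a $ i + l * (1 + e k) \<longleftrightarrow> x $ i \<le> a $ i + l" for i
      using elim by (smt (verit))
    then show ?case
      by (simp add: mem_cube_iff half_open_cube_def)
  qed
qed

lemma cube_mono:
  assumes "\<And>i. b $ i \<le> a $ i" "\<And>i. a $ i + l \<le> b $ i + m"
  shows "cube a l \<subseteq> cube b m"
  using assms unfolding subset_iff mem_cube_iff by (meson order_trans)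

text \<open>
  By doubling, a null cube would make all larger concentric cubes null, and hence the whole space.
\<close>

lemma doubling_emeasure_cube_pos:
  assumes "doubling_measure \<mu> c d" "0 < l"
  shows "0 < emeasure \<mu> (cube a l)"
proof (rule ccontr)
  assume "\<not> 0 < emeasure \<mu> (cube a l)"
  then have 0: "emeasure \<mu> (cube a l) = 0" by simp
  note sets = doubling_measureD(1)[OF assms(1)] and sp = doubling_measureD(2)[OF assms(1)]
  define Q where "Q k = cube (\<chi> i. a $ i - real k) (l + 2 * real k)" for k :: nat
  have "emeasure \<mu> (Q k) = 0" for k
  proof -
    have "cube a l \<subseteq> Q k"
      unfolding Q_def by (intro cube_mono) auto
    then have "emeasure \<mu> (Q k) \<le> ennreal (c * ((l + 2 * real k) / l) powr d) * emeasure \<mu> (cube a l)"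
      unfolding Q_def using assms(2) by (intro doubling_measureD(6)[OF assms(1)]) auto
    then show ?thesis by (simp add: 0)
  qed
  then have "emeasure \<mu> (\<Union>k. Q k) = 0"
    using sets by (intro emeasure_UN_eq_0) (auto simp: Q_def cube_borel)
  moreover have "(\<Union>k. Q k) = UNIV"
  proof -
    have "\<exists>k. x \<in> Q k" for x
    proof -
      obtain k :: nat where k: "norm (x - a) \<le> real k"
        using real_arch_simple by blast
      have "\<bar>x $ i - a $ i\<bar> \<le> real k" for i
        using component_le_norm_cart[of "x - a" i] k by simp
      then have "x \<in> Q k"
        unfolding Q_def mem_cube_iff using assms(2) by (simp add: abs_le_iff) (smt (verit))
      then show ?thesis by blast
    qed
    then show ?thesis by auto
  qed
  ultimately show False
    using sp sets_eq_imp_space_eq[OF sets] by simp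
qed

lemma doubling_half_open_cube_measure:
  assumes "doubling_measure \<mu> c d"
  shows "half_open_cube_measure \<mu>"
proof (rule half_open_cube_measure.intro)
  show sets: "sets \<mu> = sets borel"
    by (rule doubling_measureD(1)[OF assms])
  show "emeasure \<mu> (half_open_cube a l) < \<infinity>" for a l
  proof -
    have "emeasure \<mu> (half_open_cube a l) \<le> emeasure \<mu> (cube a l)"
      by (intro emeasure_mono half_open_cube_subset_cube) (simp add: sets cube_borel)
    also have "\<dots> < \<infinity>"
      by (intro emeasure_compact_finite compact_cube doubling_measureD(1,3)[OF assms])
    finally show ?thesis .
  qed
  show "0 < emeasure \<mu> (half_open_cube a l)" if "0 < l" for a l
  proof -
    have "0 < emeasure \<mu> (cube a (l / 2))"
      using assms that by (intro doubling_emeasure_cube_pos) auto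
    also have "\<dots> \<le> emeasure \<mu> (half_open_cube a l)"
    proof (intro emeasure_mono subsetI)
      fix x assume x: "x \<in> cube a (l / 2)"
      have "a $ i \<le> x $ i \<and> x $ i < a $ i + l" for i
        using x that by (auto simp: mem_cube_iff dest: spec[of _ i])
      then show "x \<in> half_open_cube a l"
        by (simp add: half_open_cube_def)
    qed (simp add: sets)
    finally show ?thesis .
  qed
qed

text \<open>
  Both half-open cubes are exhausted by closed cubes, of side lengths \<open>l (1 - e k)\<close> and
  \<open>l (1 / 2 - e k)\<close>. Shortening both sides by the same amount \<open>l * e k\<close> keeps the closed child inside its
  closed parent even at the upper faces; the ratio of the side lengths then exceeds \<open>2\<close>, but it tends
  to \<open>2\<close>.
\<close>

lemma doubling_half_open_cube:
  assumes "doubling_measure \<mu> c d" "0 < l"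
  shows "emeasure \<mu> (half_open_cube a l)
    \<le> ennreal (c * 2 powr d) * emeasure \<mu> (half_open_cube (corner a l x) (l / 2))"
proof -
  interpret half_open_cube_measure \<mu>
    using assms(1) by (rule doubling_half_open_cube_measure)
  note c = doubling_measureD(4)[OF assms(1)] and lf = doubling_measureD(3)[OF assms(1)]
    and doub = doubling_measureD(6)[OF assms(1)]
  have fin: "emeasure \<mu> (cube a l) < \<infinity>" for a l
    by (intro emeasure_compact_finite lf compact_cube sets_eq)
  let ?b = "corner a l x"
  obtain e :: "nat \<Rightarrow> real" where e0: "e \<longlonglongrightarrow> 0" and e: "\<And>k. 0 < e k" "\<And>k. e k < 1 / 2"
    using small_null_sequence by blast
  have lim: "(\<lambda>k. measure \<mu> (cube a (l * (1 - e k)))) \<longlonglongrightarrow> measure \<mu> (half_open_cube a l)"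
  proof (rule measure_tendsto_of_eventually_mem[where K = "cube a l" and f = "\<lambda>_. 0"])
    show "cube a (l * (1 - e k)) \<subseteq> cube a l" for k
      using assms(2) e(1)[of k] by (intro cube_mono) auto
    show "emeasure \<mu> (cube a l) < \<infinity>" by (rule fin)
    show "eventually (\<lambda>k. x \<in> cube a (l * (1 - e k)) \<longleftrightarrow> x \<in> half_open_cube a l) sequentially" for x
      by (intro cube_eventually_half_open_cube assms(2) e0 e(1))
  qed (simp_all add: set_integrable_def cube_borel)
  have le: "measure \<mu> (cube a (l * (1 - e k)))
      \<le> c * ((1 - e k) / (1 / 2 - e k)) powr d * measure \<mu> (half_open_cube ?b (l / 2))" for k
  proof -
    have pos: "0 < l * (1 - e k)" "0 < l * (1 / 2 - e k)"
      using e[of k] assms(2) by (auto intro!: mult_pos_pos)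
    have b: "?b $ i = a $ i \<or> ?b $ i = a $ i + l / 2" for i
      by (simp add: corner_def)
    have "cube ?b (l * (1 / 2 - e k)) \<subseteq> cube a (l * (1 - e k))"
    proof (rule cube_mono)
      fix i
      show "a $ i \<le> ?b $ i" "?b $ i + l * (1 / 2 - e k) \<le> a $ i + l * (1 - e k)"
        using b[of i] assms(2) by (auto simp: right_diff_distrib)
    qed
    from doub[OF pos(2,1) this]
    have "emeasure \<mu> (cube a (l * (1 - e k)))
        \<le> ennreal (c * ((1 - e k) / (1 / 2 - e k)) powr d) * emeasure \<mu> (cube ?b (l * (1 / 2 - e k)))"
      using assms(2) by simp
    also have "\<dots> \<le> ennreal (c * ((1 - e k) / (1 / 2 - e k)) powr d) * emeasure \<mu> (half_open_cube ?b (l / 2))"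
    proof (intro mult_left_mono emeasure_mono subsetI)
      fix y assume "y \<in> cube ?b (l * (1 / 2 - e k))"
      then have y: "?b $ i \<le> y $ i" "y $ i \<le> ?b $ i + l * (1 / 2 - e k)" for i
        by (auto simp: mem_cube_iff)
      have "l * (1 / 2 - e k) < l * (1 / 2)"
        using assms(2) e by (intro mult_strict_left_mono) auto
      then have "y $ i < ?b $ i + l / 2" for i
        using y(2)[of i] by simp
      then show "y \<in> half_open_cube ?b (l / 2)"
        using y(1) by (simp add: half_open_cube_def)
    qed auto
    finally show ?thesis
      using fin[of a "l * (1 - e k)"] emeasure_cube_finite[of ?b "l / 2"] c
      by (simp add: emeasure_eq_ennreal_measure less_top flip: ennreal_mult)
  qed
  have "(\<lambda>k. (1 - e k) / (1 / 2 - e k)) \<longlonglongrightarrow> (1 - 0) / (1 / 2 - 0)"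
    by (intro tendsto_intros e0) simp
  then have "(\<lambda>k. (1 - e k) / (1 / 2 - e k)) \<longlonglongrightarrow> 2"
    by simp
  then have "(\<lambda>k. c * ((1 - e k) / (1 / 2 - e k)) powr d * measure \<mu> (half_open_cube ?b (l / 2)))
      \<longlonglongrightarrow> c * 2 powr d * measure \<mu> (half_open_cube ?b (l / 2))"
    by (intro tendsto_intros) auto
  with lim have "measure \<mu> (half_open_cube a l) \<le> c * 2 powr d * measure \<mu> (half_open_cube ?b (l / 2))"
    by (rule LIMSEQ_le) (use le in blast)
  then show ?thesis
    using emeasure_cube_finite[of a l] emeasure_cube_finite[of ?b "l / 2"] c
    by (simp add: emeasure_eq_ennreal_measure less_top flip: ennreal_mult)
qed

lemma bmo_norm_oscillation_le:
  assumes "0 < l" "emeasure \<mu> (cube a l) \<noteq> 0" "emeasure \<mu> (cube a l) < \<infinity>" "bmo_norm \<mu> f \<le> ennreal B"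
  shows "(\<integral>\<^sup>+x\<in>cube a l. ennreal \<bar>f x - average \<mu> (cube a l) f\<bar> \<partial>\<mu>) \<le> ennreal B * emeasure \<mu> (cube a l)"
proof -
  let ?I = "\<integral>\<^sup>+x\<in>cube a l. ennreal \<bar>f x - average \<mu> (cube a l) f\<bar> \<partial>\<mu>"
  have "?I / emeasure \<mu> (cube a l) \<le> bmo_norm \<mu> f"
    unfolding bmo_norm_def using assms(1) by (intro SUP_upper2[of "cube a l"]) auto
  also have "\<dots> \<le> ennreal B" by fact
  finally have "?I / emeasure \<mu> (cube a l) * emeasure \<mu> (cube a l) \<le> ennreal B * emeasure \<mu> (cube a l)"
    by (rule mult_right_mono) simp
  then show ?thesis
    using assms(2,3) by (simp add: ennreal_divide_times)
qed

lemma young_average_cube_le: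
  fixes p \<alpha> B :: real
  assumes doubling: "doubling_measure \<mu> c d" and p: "1 \<le> p" "0 \<le> \<alpha>" and l: "0 < l"
    and f: "locally_integrable \<mu> f" and B: "0 < B" "bmo_norm \<mu> f \<le> ennreal B"
    and t: "t = c * 2 powr d * exp 1 * (p + \<alpha> + 1) * B"
  shows "(\<integral>\<^sup>+x\<in>cube a l. ennreal (young_fun p \<alpha> (\<bar>f x - average \<mu> (cube a l) f\<bar> / t)) \<partial>\<mu>)
    \<le> emeasure \<mu> (cube a l)"
proof -
  interpret half_open_cube_measure \<mu>
    using doubling by (rule doubling_half_open_cube_measure)
  note c = doubling_measureD(4)[OF doubling] and d = doubling_measureD(5)[OF doubling]
    and lf = doubling_measureD(3)[OF doubling]
  have fin: "emeasure \<mu> (cube a l) < \<infinity>" for a l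
    by (intro emeasure_compact_finite lf compact_cube sets_eq)
  have pos: "emeasure \<mu> (cube a l) \<noteq> 0" if "0 < l" for a l
    using doubling_emeasure_cube_pos[OF doubling that, of a] by simp
  have f_meas [measurable]: "f \<in> borel_measurable borel"
    using f sets_eq by (rule locally_integrable_borel_measurable)
  have f_int: "set_integrable \<mu> (cube a l) f" for a l
    using f compact_cube by (auto simp: locally_integrable_def)
  obtain e :: "nat \<Rightarrow> real" where e0: "e \<longlonglongrightarrow> 0" and e: "\<And>k. 0 < e k" "\<And>k. e k < 1 / 2"
    using small_null_sequence by blast
  interpret dyadic_bmo \<mu> f "c * 2 powr d" B
  proof
    have "1 * 1 \<le> c * 2 powr d"
      using c d by (intro mult_mono) (auto simp: ge_one_powr_ge_zero)
    then show "1 \<le> c * 2 powr d" by simp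
    show "set_integrable \<mu> (half_open_cube a l) f" for a l
      by (rule set_integrable_subset[OF f_int[of a l] _ half_open_cube_subset_cube]) simp
    show "emeasure \<mu> (half_open_cube a l)
        \<le> ennreal (c * 2 powr d) * emeasure \<mu> (half_open_cube (corner a l x) (l / 2))" if "0 < l" for a l x
      using doubling that by (rule doubling_half_open_cube)
    show "(\<integral>\<^sup>+x\<in>half_open_cube a l. ennreal \<bar>f x - average \<mu> (half_open_cube a l) f\<bar> \<partial>\<mu>)
        \<le> ennreal B * emeasure \<mu> (half_open_cube a l)" if "0 < l" for a l
    proof (rule oscillation_le_of_eventually_mem[where g = "\<lambda>s. s" and K = "cube a l"
          and S = "\<lambda>k. cube a (l * (1 - e k))"])
      fix k :: nat
      show "cube a (l * (1 - e k)) \<subseteq> cube a l"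
        using that e(1)[of k] by (intro cube_mono) auto
      have "0 < l * (1 - e k)"
        using that e(2)[of k] by (intro mult_pos_pos) auto
      then show "(\<integral>\<^sup>+x\<in>cube a (l * (1 - e k)).
          ennreal \<bar>f x - average \<mu> (cube a (l * (1 - e k))) f\<bar> \<partial>\<mu>)
          \<le> ennreal B * emeasure \<mu> (cube a (l * (1 - e k)))"
        by (intro bmo_norm_oscillation_le pos fin B)
    qed (use that B fin[of a l] f_int emeasure_cube_finite[of a l] in
          \<open>auto simp: cube_borel measure_cube_pos intro!: cube_eventually_half_open_cube e0 e(1) continuous_intros\<close>)
  qed (use B in auto)
  have tpos: "0 < t"
    using c B p unfolding t by (intro mult_pos_pos) auto
  have "(\<integral>\<^sup>+x\<in>cube a l. ennreal (young_fun p \<alpha> (\<bar>f x - average \<mu> (cube a l) f\<bar> / t)) \<partial>\<mu>)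
      \<le> ennreal 1 * emeasure \<mu> (cube a l)"
  proof (rule oscillation_le_of_eventually_mem[where g = "\<lambda>s. young_fun p \<alpha> (s / t)" and K = "cube a (l * 2)"
          and S = "\<lambda>k. half_open_cube a (l * (1 + e k))"])
    fix k :: nat
    have "l * (1 + e k) \<le> l * 2"
      using l e(2)[of k] by (intro mult_left_mono) auto
    then show "half_open_cube a (l * (1 + e k)) \<subseteq> cube a (l * 2)"
      by (smt (verit, best) mem_cube_iff half_open_cube_def mem_Collect_eq subsetI)
    have "0 < l * (1 + e k)"
      using l e(1)[of k] by (intro mult_pos_pos) auto
    from young_average_le[OF p t this, of a]
    show "(\<integral>\<^sup>+x\<in>half_open_cube a (l * (1 + e k)). ennreal (young_fun p \<alpha>
          (\<bar>f x - average \<mu> (half_open_cube a (l * (1 + e k))) f\<bar> / t)) \<partial>\<mu>)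
        \<le> ennreal 1 * emeasure \<mu> (half_open_cube a (l * (1 + e k)))"
      by simp
  next
    show "continuous_on {0..} (\<lambda>s. young_fun p \<alpha> (s / t))"
      using p tpos by (intro continuous_on_compose2[OF continuous_on_young_fun] continuous_intros) auto
    show "0 < measure \<mu> (cube a l)"
      using fin[of a l] pos[OF l, of a] by (simp add: measure_def enn2real_positive_iff less_top zero_less_iff_neq_zero)
  qed (use fin[of a l] fin[of a "l * 2"] f_int in
        \<open>auto simp: cube_borel intro!: half_open_cube_eventually_cube l e0 e(1)\<close>)
  then show ?thesis by simp
qed

section \<open>The Luxemburg norm estimate\<close>

theorem corollary1p1:
  fixes \<mu> :: "(real ^ 'n) measure"
    and c_\<mu> n_\<mu> p \<alpha> l :: real
    and a :: "real ^ 'n"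
    and f :: "real ^ 'n \<Rightarrow> real"
  assumes "doubling_measure \<mu> c_\<mu> n_\<mu>"
    and "1 < p" and "0 \<le> \<alpha>"
    and "0 < l" and "Q = cube a l"
    and "f \<in> BMO \<mu>"
  shows "luxemburg_norm p \<alpha> \<mu> Q (\<lambda>x. f x - average \<mu> Q f)
    \<le> ennreal (c_\<mu> * 2 powr n_\<mu> * exp 1 * 2 powr \<alpha> * (p + \<alpha> + 1)) * bmo_norm \<mu> f"
proof -
  let ?L = "luxemburg_norm p \<alpha> \<mu> Q (\<lambda>x. f x - average \<mu> Q f)"
  define k where "k = c_\<mu> * 2 powr n_\<mu> * exp 1 * (p + \<alpha> + 1)"
  note sets = doubling_measureD(1)[OF assms(1)] and lf = doubling_measureD(3)[OF assms(1)]
    and c = doubling_measureD(4)[OF assms(1)]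
  have k: "0 < k"
    using c assms(2,3) unfolding k_def by (intro mult_pos_pos) auto
  have f: "locally_integrable \<mu> f"
    using assms(6) by (simp add: BMO_def)
  obtain b where b: "bmo_norm \<mu> f = ennreal b" "0 \<le> b"
    using assms(6) by (cases "bmo_norm \<mu> f") (auto simp: BMO_def)
  have Q: "0 < emeasure \<mu> Q" "emeasure \<mu> Q < \<infinity>"
    using doubling_emeasure_cube_pos[OF assms(1,4)] emeasure_compact_finite[OF lf sets compact_cube]
    unfolding assms(5) by auto
  \<comment> \<open>A bound strictly above the BMO norm is positive even for constant \<open>f\<close>, as the dyadic argument requires.\<close>
  have le: "?L \<le> ennreal (k * B)" if "b < B" for B
  proof -
    have "(\<integral>\<^sup>+x\<in>Q. ennreal (young_fun p \<alpha> (\<bar>f x - average \<mu> Q f\<bar> / (k * B))) \<partial>\<mu>) \<le> emeasure \<mu> Q"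
      unfolding assms(5) using that b assms(2)
      by (intro young_average_cube_le[OF assms(1) _ assms(3,4) f, of p B]) (auto simp: k_def)
    then have "(\<integral>\<^sup>+x\<in>Q. ennreal (young_fun p \<alpha> (\<bar>f x - average \<mu> Q f\<bar> / (k * B))) \<partial>\<mu>) / emeasure \<mu> Q \<le> 1"
      using Q by (intro divide_le_posI_ennreal) auto
    moreover have "0 < k * B"
      using k that b by simp
    ultimately show ?thesis
      unfolding luxemburg_norm_def by (intro INF_lower) simp
  qed
  have "?L \<le> ennreal (k * b)"
  proof (rule ennreal_le_epsilon)
    fix e :: real assume "0 < e"
    then have "?L \<le> ennreal (k * (b + e / k))"
      using k by (intro le) simp
    also have "\<dots> = ennreal (k * b) + ennreal e"
      using k b \<open>0 < e\<close> by (simp add: distrib_left flip: ennreal_plus)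
    finally show "?L \<le> ennreal (k * b) + ennreal e" .
  qed
  also have "\<dots> \<le> ennreal (k * 2 powr \<alpha>) * bmo_norm \<mu> f"
  proof -
    have "k * 1 \<le> k * 2 powr \<alpha>"
      using k assms(3) by (intro mult_left_mono) (auto simp: ge_one_powr_ge_zero)
    then show ?thesis
      using b k by (simp add: mult_right_mono flip: ennreal_mult)
  qed
  also have "k * 2 powr \<alpha> = c_\<mu> * 2 powr n_\<mu> * exp 1 * 2 powr \<alpha> * (p + \<alpha> + 1)"
    by (simp add: k_def mult_ac)
  finally show ?thesis .
qed

end
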